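(* Let $\Omega\subset\mathbb C^m$ be a Reinhardt domain with $0\in\Omega$. Let $\mathscr H$ be a reproducing kernel Hilbert space of functions on $\Omega$ which is invariant under multiplication by each coordinate function $z_1,\dots,z_m$, such that $\mathscr H\subset\mathrm{Hol}(\Omega)$ with continuous inclusion, and let $\kappa(z,w)$ $(z,w\in\Omega)$ be its reproducing kernel. Then the following are equivalent: (1) for every $\zeta\in\mathbb T^m$, $\kappa(\zeta\cdot z,\zeta\cdot w)=\kappa(z,w)$ for all $z,w\in\Omega$, where $\zeta\cdot z=(\zeta_1z_1,\dots,\zeta_mz_m)$; (2) for every $\zeta\in\mathbb T^m$, $f(\zeta\,\cdot)\in\mathscr H$ whenever $f\in\mathscr H$, and $\langle f(\zeta\,\cdot),g(\zeta\,\cdot)\rangle=\langle f,g\rangle$ for all $f,g\in\mathscr H$; (3) there exist a multi-sequence $\{\beta_n\}_{n\in\mathbb N^m}$ of positive numbers and an inductive set $\Lambda\subset\mathbb N^m$ such that $\mathscr H=H^2(\beta)_\Lambda$; (4) there exists an inductive set $\Lambda'\subset\mathbb N^m$ such that the functions $z^n$, $n\in\Lambda'$, belong to $\mathscr H$ and form an orthogonal basis of $\mathscr H$; (5) there exist an inductive set $\Lambda''\subset\mathbb N^m$ and positive numbers $\{\alpha_n\}_{n\in\Lambda''}$ such that $\kappa(z,w)=\sum_{n\in\Lambda''}\alpha_nz^n\overline w^n$ for $z,w\in\Omega$. Moreover, if (1)–(5) hold, then $\Lambda=\Lambda'=\Lambda''$.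
   Context: $\mathbb N=\{0,1,2,\dots\}$, $\mathbb T$ is the unit circle. A set $\Lambda\subset\mathbb N^m$ is inductive if $n\in\Lambda$ implies $n+\epsilon_j\in\Lambda$ for $j=1,\dots,m$, where $\epsilon_j$ is the $j$-th unit multi-index. For a positive multi-sequence $\beta$, $H^2(\beta)$ is the Hilbert space of formal power series $f=\sum a_nz^n$ with $\|f\|^2=\sum|a_n|^2\beta_n^2<\infty$, and $H^2(\beta)_\Lambda=\{f\in H^2(\beta): D^nf(0)=0 \text{ for all } n\in\mathbb N^m\setminus\Lambda\}$ (i.e. the coefficients $a_n$ vanish for $n\notin\Lambda$). The equality $\mathscr H=H^2(\beta)_\Lambda$ means that, identifying analytic functions on $\Omega$ with their Taylor series at the origin, the two spaces consist of the same functions and have identical norms. *)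

theory Defs
  imports "HOL-Analysis.Analysis"
begin

text \<open>Points of C^m are vectors complex^'m ('m a finite index type, m = CARD('m));
  multi-indices n in N^m are functions 'm => nat.  Functions on Omega are
  represented as total functions complex^'m => complex that vanish outside Omega.\<close>

definition torus :: "complex ^ 'm \<Rightarrow> bool" where
  "torus \<zeta> \<longleftrightarrow> (\<forall>i. cmod (\<zeta> $ i) = 1)"

definition tmult :: "complex ^ 'm \<Rightarrow> complex ^ 'm \<Rightarrow> complex ^ 'm" where
  "tmult \<zeta> z = (\<chi> i. \<zeta> $ i * z $ i)"

definition zpow :: "complex ^ 'm \<Rightarrow> ('m::finite \<Rightarrow> nat) \<Rightarrow> complex" where
  "zpow z n = (\<Prod>i\<in>UNIV. (z $ i) ^ (n i))"

definition inductive_mset :: "('m \<Rightarrow> nat) set \<Rightarrow> bool" where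
  "inductive_mset \<Lambda> \<longleftrightarrow> (\<forall>n\<in>\<Lambda>. \<forall>j. n(j := n j + 1) \<in> \<Lambda>)"

definition reinhardt_domain :: "(complex ^ 'm) set \<Rightarrow> bool" where
  "reinhardt_domain \<Omega> \<longleftrightarrow> open \<Omega> \<and> connected \<Omega> \<and> \<Omega> \<noteq> {} \<and>
     (\<forall>\<zeta> z. torus \<zeta> \<and> z \<in> \<Omega> \<longrightarrow> tmult \<zeta> z \<in> \<Omega>)"

definition holo_on :: "(complex ^ 'm) set \<Rightarrow> (complex ^ 'm \<Rightarrow> complex) \<Rightarrow> bool" where
  "holo_on \<Omega> f \<longleftrightarrow> (\<forall>z\<in>\<Omega>. \<exists>f'. (f has_derivative f') (at z) \<and>
       (\<forall>c v. f' (c *s v) = c * f' v))"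

definition hnorm :: "(('a \<Rightarrow> complex) \<Rightarrow> ('a \<Rightarrow> complex) \<Rightarrow> complex) \<Rightarrow> ('a \<Rightarrow> complex) \<Rightarrow> real" where
  "hnorm ip f = sqrt (Re (ip f f))"

definition hilbert_fs :: "(complex ^ 'm) set \<Rightarrow> (complex ^ 'm \<Rightarrow> complex) set
     \<Rightarrow> ((complex ^ 'm \<Rightarrow> complex) \<Rightarrow> (complex ^ 'm \<Rightarrow> complex) \<Rightarrow> complex) \<Rightarrow> bool" where
  "hilbert_fs \<Omega> H ip \<longleftrightarrow>
     (\<forall>f\<in>H. \<forall>z. z \<notin> \<Omega> \<longrightarrow> f z = 0) \<and>
     (\<lambda>z. 0) \<in> H \<and>
     (\<forall>f\<in>H. \<forall>g\<in>H. (\<lambda>z. f z + g z) \<in> H) \<and>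
     (\<forall>f\<in>H. \<forall>c. (\<lambda>z. c * f z) \<in> H) \<and>
     (\<forall>f\<in>H. \<forall>g\<in>H. \<forall>h\<in>H. ip (\<lambda>z. f z + g z) h = ip f h + ip g h) \<and>
     (\<forall>f\<in>H. \<forall>h\<in>H. \<forall>c. ip (\<lambda>z. c * f z) h = c * ip f h) \<and>
     (\<forall>f\<in>H. \<forall>g\<in>H. ip g f = cnj (ip f g)) \<and>
     (\<forall>f\<in>H. Re (ip f f) \<ge> 0) \<and>
     (\<forall>f\<in>H. ip f f = 0 \<longrightarrow> f = (\<lambda>z. 0)) \<and>
     (\<forall>X. (\<forall>k. X k \<in> H) \<and>
          (\<forall>e>0. \<exists>N. \<forall>p\<ge>N. \<forall>q\<ge>N. hnorm ip (\<lambda>z. X p z - X q z) < e)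
        \<longrightarrow> (\<exists>f\<in>H. (\<lambda>k. hnorm ip (\<lambda>z. X k z - f z)) \<longlonglongrightarrow> 0))"

definition repr_kernel :: "(complex ^ 'm) set \<Rightarrow> (complex ^ 'm \<Rightarrow> complex) set
     \<Rightarrow> ((complex ^ 'm \<Rightarrow> complex) \<Rightarrow> (complex ^ 'm \<Rightarrow> complex) \<Rightarrow> complex)
     \<Rightarrow> (complex ^ 'm \<Rightarrow> complex ^ 'm \<Rightarrow> complex) \<Rightarrow> bool" where
  "repr_kernel \<Omega> H ip \<kappa> \<longleftrightarrow>
     (\<forall>w\<in>\<Omega>. (\<lambda>z. if z \<in> \<Omega> then \<kappa> z w else 0) \<in> H \<and>
        (\<forall>f\<in>H. f w = ip f (\<lambda>z. if z \<in> \<Omega> then \<kappa> z w else 0)))"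

text \<open>The inclusion H \<subseteq> Hol(Omega) is continuous (Hol(Omega) with the topology of
  locally uniform convergence).\<close>
definition cont_incl_hol :: "(complex ^ 'm) set \<Rightarrow> (complex ^ 'm \<Rightarrow> complex) set
     \<Rightarrow> ((complex ^ 'm \<Rightarrow> complex) \<Rightarrow> (complex ^ 'm \<Rightarrow> complex) \<Rightarrow> complex) \<Rightarrow> bool" where
  "cont_incl_hol \<Omega> H ip \<longleftrightarrow> (\<forall>f\<in>H. holo_on \<Omega> f) \<and>
     (\<forall>K. compact K \<and> K \<subseteq> \<Omega> \<longrightarrow> (\<exists>C. \<forall>f\<in>H. \<forall>z\<in>K. cmod (f z) \<le> C * hnorm ip f))"

definition taylor0 :: "(complex ^ 'm \<Rightarrow> complex) \<Rightarrow> (('m::finite \<Rightarrow> nat) \<Rightarrow> complex) \<Rightarrow> bool" where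
  "taylor0 f a \<longleftrightarrow> (\<exists>r>0. \<forall>z. (\<forall>i. cmod (z $ i) < r) \<longrightarrow>
       ((\<lambda>n. a n * zpow z n) has_sum f z) UNIV)"

definition eq_H2 :: "(complex ^ 'm::finite \<Rightarrow> complex) set
     \<Rightarrow> ((complex ^ 'm \<Rightarrow> complex) \<Rightarrow> (complex ^ 'm \<Rightarrow> complex) \<Rightarrow> complex)
     \<Rightarrow> (('m \<Rightarrow> nat) \<Rightarrow> real) \<Rightarrow> ('m \<Rightarrow> nat) set \<Rightarrow> bool" where
  "eq_H2 H ip \<beta> \<Lambda> \<longleftrightarrow>
     (\<forall>f\<in>H. \<exists>a. taylor0 f a \<and> (\<forall>n. n \<notin> \<Lambda> \<longrightarrow> a n = 0) \<and>
         ((\<lambda>n. (cmod (a n))\<^sup>2 * (\<beta> n)\<^sup>2) has_sum (hnorm ip f)\<^sup>2) UNIV) \<and>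
     (\<forall>a. (\<forall>n. n \<notin> \<Lambda> \<longrightarrow> a n = 0) \<and> (\<lambda>n. (cmod (a n))\<^sup>2 * (\<beta> n)\<^sup>2) summable_on UNIV
         \<longrightarrow> (\<exists>f\<in>H. taylor0 f a))"

definition mono_fn :: "(complex ^ 'm) set \<Rightarrow> ('m::finite \<Rightarrow> nat) \<Rightarrow> complex ^ 'm \<Rightarrow> complex" where
  "mono_fn \<Omega> n = (\<lambda>z. if z \<in> \<Omega> then zpow z n else 0)"

definition P1 where
  "P1 \<Omega> \<kappa> \<longleftrightarrow> (\<forall>\<zeta>. torus \<zeta> \<longrightarrow> (\<forall>z\<in>\<Omega>. \<forall>w\<in>\<Omega>. \<kappa> (tmult \<zeta> z) (tmult \<zeta> w) = \<kappa> z w))"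

definition P2 where
  "P2 H ip \<longleftrightarrow> (\<forall>\<zeta>. torus \<zeta> \<longrightarrow>
      (\<forall>f\<in>H. (\<lambda>z. f (tmult \<zeta> z)) \<in> H) \<and>
      (\<forall>f\<in>H. \<forall>g\<in>H. ip (\<lambda>z. f (tmult \<zeta> z)) (\<lambda>z. g (tmult \<zeta> z)) = ip f g))"

definition P3 where
  "P3 H ip \<beta> \<Lambda> \<longleftrightarrow> (\<forall>n. \<beta> n > 0) \<and> inductive_mset \<Lambda> \<and> eq_H2 H ip \<beta> \<Lambda>"

definition P4 where
  "P4 \<Omega> H ip \<Lambda>' \<longleftrightarrow> inductive_mset \<Lambda>' \<and> (\<forall>n\<in>\<Lambda>'. mono_fn \<Omega> n \<in> H) \<and>
     (\<forall>n\<in>\<Lambda>'. mono_fn \<Omega> n \<noteq> (\<lambda>z. 0)) \<and>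
     (\<forall>n\<in>\<Lambda>'. \<forall>k\<in>\<Lambda>'. n \<noteq> k \<longrightarrow> ip (mono_fn \<Omega> n) (mono_fn \<Omega> k) = 0) \<and>
     (\<forall>f\<in>H. (\<forall>n\<in>\<Lambda>'. ip f (mono_fn \<Omega> n) = 0) \<longrightarrow> f = (\<lambda>z. 0))"

definition P5 where
  "P5 \<Omega> \<kappa> \<Lambda>'' \<alpha> \<longleftrightarrow> inductive_mset \<Lambda>'' \<and> (\<forall>n\<in>\<Lambda>''. \<alpha> n > (0::real)) \<and>
     (\<forall>z\<in>\<Omega>. \<forall>w\<in>\<Omega>. ((\<lambda>n. complex_of_real (\<alpha> n) * zpow z n * cnj (zpow w n)) has_sum \<kappa> z w) \<Lambda>'')"

end

theory Submission
  imports Defs "HOL-Complex_Analysis.Complex_Singularities"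
begin

text \<open>
  The hard step is that an invariant space is spanned by the monomials it contains.  In each
  coordinate, average \<open>\<theta>\<^sup>-\<^sup>k f(\<theta> z\<^sub>j)\<close> over the \<open>2\<^sup>p\<close>-th roots of unity.  Under invariance these averages
  are orthogonal projections that decrease with \<open>p\<close>, so they converge in norm, and the limit is
  homogeneous of degree \<open>k\<close> in \<open>z\<^sub>j\<close>.  If \<open>f\<close> is nonzero, some \<open>k\<close> gives a nonzero limit.  Doing this in
  every coordinate turns a nonzero \<open>f\<close> orthogonal to all monomials of the space into a nonzero
  function, still orthogonal to them, that is homogeneous in each variable; by the identity theorem
  it is a multiple of a monomial, a contradiction.  The passage from the kernel to the inner product
  uses density of the functions on which the rotation is already known to be isometric, among them
  the kernel functions; the series statements are Parseval's identity for the monomials.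
\<close>

section \<open>Hilbert spaces of functions\<close>

text \<open>Averages over roots of unity stand in for the Fourier integral over the circle. Finite
  sums stay in \<open>H\<close> by linearity alone, whereas integrating rotated functions would call
  for a vector-valued integral and norm continuity of the rotations. The orders \<open>2 ^ p\<close>
  make the groups of roots nested, and nesting is what turns the averages into a decreasing family
  of projections. The price is that homogeneity of a limit is known only for dyadic roots; these
  accumulate on the circle, so the identity theorem recovers the rest. The second obstacle is the
  domain, which need not be a polydisc: uniqueness of Taylor coefficients is settled on a small
  polydisc at 0, and equalities of functions are carried to \<open>\<Omega>\<close> by
  connectedness.\<close>

locale hilbert_functions =
  fixes \<Omega> :: "(complex ^ 'm::finite) set"
    and H :: "(complex ^ 'm \<Rightarrow> complex) set"
    and ip :: "(complex ^ 'm \<Rightarrow> complex) \<Rightarrow> (complex ^ 'm \<Rightarrow> complex) \<Rightarrow> complex"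
  assumes hilbert: "hilbert_fs \<Omega> H ip"
begin

lemma
  shows vanish_outside: "\<lbrakk>f \<in> H; z \<notin> \<Omega>\<rbrakk> \<Longrightarrow> f z = 0"
    and zero_mem: "(\<lambda>z. 0) \<in> H"
    and add_mem: "\<lbrakk>f \<in> H; g \<in> H\<rbrakk> \<Longrightarrow> (\<lambda>z. f z + g z) \<in> H"
    and scale_mem: "f \<in> H \<Longrightarrow> (\<lambda>z. c * f z) \<in> H"
    and ip_add_left: "\<lbrakk>f \<in> H; g \<in> H; h \<in> H\<rbrakk> \<Longrightarrow> ip (\<lambda>z. f z + g z) h = ip f h + ip g h"
    and ip_scale_left: "\<lbrakk>f \<in> H; h \<in> H\<rbrakk> \<Longrightarrow> ip (\<lambda>z. c * f z) h = c * ip f h"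
    and ip_cnj: "\<lbrakk>f \<in> H; g \<in> H\<rbrakk> \<Longrightarrow> ip g f = cnj (ip f g)"
    and ip_nonneg: "f \<in> H \<Longrightarrow> 0 \<le> Re (ip f f)"
    and ip_definite: "\<lbrakk>f \<in> H; ip f f = 0\<rbrakk> \<Longrightarrow> f = (\<lambda>z. 0)"
  using hilbert unfolding hilbert_fs_def by blast+

lemma diff_mem: "\<lbrakk>f \<in> H; g \<in> H\<rbrakk> \<Longrightarrow> (\<lambda>z. f z - g z) \<in> H"
  using add_mem[of f "\<lambda>z. (-1) * g z"] scale_mem[of g "-1"] by simp

lemma sum_mem: "(\<And>i. i \<in> A \<Longrightarrow> F i \<in> H) \<Longrightarrow> (\<lambda>z. \<Sum>i\<in>A. F i z) \<in> H"
  by (induction A rule: infinite_finite_induct) (auto simp: zero_mem add_mem)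

lemma ip_diff_left: "\<lbrakk>f \<in> H; g \<in> H; h \<in> H\<rbrakk> \<Longrightarrow> ip (\<lambda>z. f z - g z) h = ip f h - ip g h"
  using ip_add_left[of f "\<lambda>z. (-1) * g z" h] scale_mem[of g "-1"] ip_scale_left[of g h "-1"] by simp

lemma ip_zero_left: "h \<in> H \<Longrightarrow> ip (\<lambda>z. 0) h = 0"
  using ip_scale_left[of "\<lambda>z. 0" h 0] zero_mem by simp

lemma ip_sum_left:
  "\<lbrakk>\<And>i. i \<in> A \<Longrightarrow> F i \<in> H; h \<in> H\<rbrakk> \<Longrightarrow> ip (\<lambda>z. \<Sum>i\<in>A. F i z) h = (\<Sum>i\<in>A. ip (F i) h)"
proof (induction A rule: infinite_finite_induct)
  case (insert i A)
  then show ?case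
    using ip_add_left[of "F i" "\<lambda>z. \<Sum>i\<in>A. F i z" h] sum_mem[of A F] by simp
qed (auto simp: ip_zero_left)

lemma ip_zero_right: "h \<in> H \<Longrightarrow> ip h (\<lambda>z. 0) = 0"
  using ip_cnj[of "\<lambda>z. 0" h] ip_zero_left zero_mem by simp

lemma ip_add_right: "\<lbrakk>f \<in> H; g \<in> H; h \<in> H\<rbrakk> \<Longrightarrow> ip h (\<lambda>z. f z + g z) = ip h f + ip h g"
  by (simp add: ip_cnj[of _ h] add_mem ip_add_left)

lemma ip_diff_right: "\<lbrakk>f \<in> H; g \<in> H; h \<in> H\<rbrakk> \<Longrightarrow> ip h (\<lambda>z. f z - g z) = ip h f - ip h g"
  by (simp add: ip_cnj[of _ h] diff_mem ip_diff_left)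

lemma ip_scale_right: "\<lbrakk>f \<in> H; h \<in> H\<rbrakk> \<Longrightarrow> ip h (\<lambda>z. c * f z) = cnj c * ip h f"
  by (simp add: ip_cnj[of _ h] scale_mem ip_scale_left)

lemma ip_self: "f \<in> H \<Longrightarrow> ip f f = complex_of_real ((hnorm ip f)\<^sup>2)"
  using ip_cnj[of f f] ip_nonneg[of f] by (auto simp: hnorm_def complex_eq_iff)

lemma hnorm_sq: "f \<in> H \<Longrightarrow> (hnorm ip f)\<^sup>2 = Re (ip f f)"
  by (simp add: ip_self)

lemma hnorm_nonneg: "f \<in> H \<Longrightarrow> 0 \<le> hnorm ip f"
  by (simp add: hnorm_def ip_nonneg)

lemma hnorm_pos: "\<lbrakk>f \<in> H; f \<noteq> (\<lambda>z. 0)\<rbrakk> \<Longrightarrow> 0 < hnorm ip f"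
  using ip_definite[of f] hnorm_nonneg[of f] ip_self[of f] by (cases "hnorm ip f = 0") auto

lemma parallelogram:
  "\<lbrakk>f \<in> H; g \<in> H\<rbrakk> \<Longrightarrow> (hnorm ip (\<lambda>z. f z - g z))\<^sup>2 + (hnorm ip (\<lambda>z. f z + g z))\<^sup>2
      = 2 * (hnorm ip f)\<^sup>2 + 2 * (hnorm ip g)\<^sup>2"
  by (simp add: hnorm_sq diff_mem add_mem ip_diff_left ip_diff_right ip_add_left ip_add_right)

lemma hnorm_diff_sq_le:
  "\<lbrakk>f \<in> H; g \<in> H\<rbrakk> \<Longrightarrow> (hnorm ip (\<lambda>z. f z - g z))\<^sup>2 \<le> 2 * (hnorm ip f)\<^sup>2 + 2 * (hnorm ip g)\<^sup>2"
  using parallelogram[of f g] zero_le_power2[of "hnorm ip (\<lambda>z. f z + g z)"] by linarith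

lemma hnorm_diff_sq:
  "\<lbrakk>f \<in> H; g \<in> H\<rbrakk> \<Longrightarrow> (hnorm ip (\<lambda>z. f z - g z))\<^sup>2
      = (hnorm ip f)\<^sup>2 + (hnorm ip g)\<^sup>2 - 2 * Re (ip f g)"
  by (simp add: hnorm_sq diff_mem ip_diff_left ip_diff_right ip_cnj[of f g])

lemma hnorm_scale_sq: "f \<in> H \<Longrightarrow> (hnorm ip (\<lambda>z. c * f z))\<^sup>2 = (cmod c)\<^sup>2 * (hnorm ip f)\<^sup>2"
proof -
  assume f: "f \<in> H"
  have "ip (\<lambda>z. c * f z) (\<lambda>z. c * f z) = (c * cnj c) * ip f f"
    using f by (simp add: scale_mem ip_scale_left ip_scale_right)
  also have "\<dots> = complex_of_real ((cmod c)\<^sup>2 * (hnorm ip f)\<^sup>2)"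
    by (simp add: complex_norm_square[symmetric] ip_self f)
  finally show ?thesis
    by (simp add: hnorm_sq[OF scale_mem[OF f]])
qed

text \<open>Choose the \<open>c\<close> that minimises the squared distance from \<open>f\<close> to
  the multiples of \<open>g\<close>. With \<open>d = 0\<close> this is Cauchy-Schwarz; with
  \<open>d\<close> the squared distance to a subspace it says that near-minimisers leave remainders
  nearly orthogonal to the subspace.\<close>

lemma distance_to_line:
  assumes f: "f \<in> H" and g: "g \<in> H" and d: "\<And>c. d \<le> (hnorm ip (\<lambda>z. f z - c * g z))\<^sup>2"
  shows "(cmod (ip f g))\<^sup>2 \<le> (hnorm ip g)\<^sup>2 * ((hnorm ip f)\<^sup>2 - d)"
proof (cases "g = (\<lambda>z. 0)")
  case True
  then show ?thesis
    using f g ip_self[OF g] by (simp add: ip_zero_right)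
next
  case False
  define G where "G = (hnorm ip g)\<^sup>2"
  have G: "G > 0" using hnorm_pos[OF g False] by (simp add: G_def)
  define c where "c = ip f g / complex_of_real G"
  have "d \<le> (hnorm ip f)\<^sup>2 + (cmod c)\<^sup>2 * G - 2 * Re (cnj c * ip f g)"
    using d[of c] f g by (simp add: hnorm_diff_sq scale_mem hnorm_scale_sq ip_scale_right G_def)
  also have "cnj c * ip f g = complex_of_real ((cmod (ip f g))\<^sup>2 / G)"
    unfolding c_def by (simp add: complex_norm_square[unfolded of_real_power] mult.commute)
  also have "(cmod c)\<^sup>2 * G = (cmod (ip f g))\<^sup>2 / G"
    using G by (simp add: c_def norm_divide power_divide power2_eq_square)
  finally have "(cmod (ip f g))\<^sup>2 / G \<le> (hnorm ip f)\<^sup>2 - d" by simp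
  then show ?thesis using G by (simp add: G_def[symmetric] field_simps)
qed

lemma Cauchy_Schwarz:
  assumes f: "f \<in> H" and g: "g \<in> H"
  shows "cmod (ip f g) \<le> hnorm ip f * hnorm ip g"
proof -
  have "(cmod (ip f g))\<^sup>2 \<le> (hnorm ip f * hnorm ip g)\<^sup>2"
    using distance_to_line[OF f g, of 0] by (simp add: power_mult_distrib mult.commute)
  then show ?thesis
    by (rule power2_le_imp_le) (simp add: f g hnorm_nonneg)
qed

text \<open>Membership in \<open>H\<close> is part of the notion because the axioms constrain
  \<open>ip\<close> only on \<open>H\<close>.\<close>

definition converges :: "(nat \<Rightarrow> complex ^ 'm \<Rightarrow> complex) \<Rightarrow> (complex ^ 'm \<Rightarrow> complex) \<Rightarrow> bool" where
  "converges X f \<longleftrightarrow> (\<forall>k. X k \<in> H) \<and> f \<in> H \<and> (\<lambda>k. hnorm ip (\<lambda>z. X k z - f z)) \<longlonglongrightarrow> 0"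

lemma convergesD:
  assumes "converges X f"
  shows "X k \<in> H" "f \<in> H" "(\<lambda>k. hnorm ip (\<lambda>z. X k z - f z)) \<longlonglongrightarrow> 0"
  using assms by (auto simp: converges_def)

lemma converges_ip:
  assumes X: "converges X f" and g: "g \<in> H"
  shows "(\<lambda>k. ip (X k) g) \<longlonglongrightarrow> ip f g"
proof -
  have "(\<lambda>k. hnorm ip (\<lambda>z. X k z - f z) * hnorm ip g) \<longlonglongrightarrow> 0 * hnorm ip g"
    by (intro tendsto_intros convergesD[OF X])
  then have "(\<lambda>k. ip (X k) g - ip f g) \<longlonglongrightarrow> 0"
  proof (rule Lim_null_comparison[rotated, OF tendsto_eq_rhs])
    show "\<forall>\<^sub>F k in sequentially. cmod (ip (X k) g - ip f g) \<le> hnorm ip (\<lambda>z. X k z - f z) * hnorm ip g"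
      using Cauchy_Schwarz[OF diff_mem[OF convergesD(1,2)[OF X]] g] convergesD(1,2)[OF X] g
      by (simp add: ip_diff_left)
  qed simp
  then show ?thesis by (rule LIM_zero_cancel)
qed

lemma complete_sq:
  assumes X: "\<And>k. X k \<in> H"
    and C: "\<And>e. e > 0 \<Longrightarrow> \<exists>N. \<forall>p\<ge>N. \<forall>q\<ge>N. (hnorm ip (\<lambda>z. X p z - X q z))\<^sup>2 < e"
  obtains f where "converges X f"
proof -
  have "\<forall>e>0. \<exists>N. \<forall>p\<ge>N. \<forall>q\<ge>N. hnorm ip (\<lambda>z. X p z - X q z) < e"
  proof (intro allI impI)
    fix e :: real assume e: "e > 0"
    then obtain N where "\<forall>p\<ge>N. \<forall>q\<ge>N. (hnorm ip (\<lambda>z. X p z - X q z))\<^sup>2 < e\<^sup>2"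
      using C[of "e\<^sup>2"] by auto
    then show "\<exists>N. \<forall>p\<ge>N. \<forall>q\<ge>N. hnorm ip (\<lambda>z. X p z - X q z) < e"
      using e by (meson less_imp_le power2_less_imp_less)
  qed
  then obtain f where "f \<in> H" "(\<lambda>k. hnorm ip (\<lambda>z. X k z - f z)) \<longlonglongrightarrow> 0"
    using hilbert X unfolding hilbert_fs_def by blast
  then show ?thesis using that X by (auto simp: converges_def)
qed

text \<open>In both applications \<open>s\<close> is a monotone bounded sequence of squared norms
  whose increments are, up to sign, the squared distances.\<close>

lemma complete_Cauchy:
  assumes X: "\<And>k. X k \<in> H" and s: "Cauchy (s :: nat \<Rightarrow> real)"
    and le: "\<And>p q. p \<le> q \<Longrightarrow> (hnorm ip (\<lambda>z. X p z - X q z))\<^sup>2 \<le> \<bar>s p - s q\<bar>"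
  obtains f where "converges X f"
proof (rule complete_sq[OF X])
  fix e :: real assume "e > 0"
  then obtain N where N: "\<forall>p\<ge>N. \<forall>q\<ge>N. \<bar>s p - s q\<bar> < e"
    using s by (auto simp: Cauchy_def dist_real_def)
  have sym: "(hnorm ip (\<lambda>z. X p z - X q z))\<^sup>2 = (hnorm ip (\<lambda>z. X q z - X p z))\<^sup>2" for p q
    using hnorm_scale_sq[OF diff_mem[OF X X], of "-1" q p] by simp
  have "(hnorm ip (\<lambda>z. X p z - X q z))\<^sup>2 < e" if "p \<ge> N" "q \<ge> N" for p q
    using le[of p q] le[of q p] sym[of p q] N that by (smt (verit) linorder_linear)
  then show "\<exists>N. \<forall>p\<ge>N. \<forall>q\<ge>N. (hnorm ip (\<lambda>z. X p z - X q z))\<^sup>2 < e" by blast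
qed (use that in blast)

text \<open>A sequence in \<open>V\<close> minimising the distance to \<open>f\<close> is Cauchy by
  the parallelogram law. Its limit \<open>s\<close> leaves a remainder \<open>f - s\<close>
  orthogonal to \<open>V\<close>, which totality forces to be 0. The approximants lie in
  \<open>V\<close> itself, not in its closure, so that properties known only on \<open>V\<close> can
  be passed to the limit.\<close>

lemma subspace_dense:
  assumes V: "V \<subseteq> H" "(\<lambda>z. 0) \<in> V"
    and add: "\<And>f g. \<lbrakk>f \<in> V; g \<in> V\<rbrakk> \<Longrightarrow> (\<lambda>z. f z + g z) \<in> V"
    and scale: "\<And>f c. f \<in> V \<Longrightarrow> (\<lambda>z. c * f z) \<in> V"
    and total: "\<And>h. \<lbrakk>h \<in> H; \<And>g. g \<in> V \<Longrightarrow> ip h g = 0\<rbrakk> \<Longrightarrow> h = (\<lambda>z. 0)"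
    and f: "f \<in> H"
  obtains X where "\<And>k. X k \<in> V" "converges X f"
proof -
  define Q where "Q v = (hnorm ip (\<lambda>z. f z - v z))\<^sup>2" for v
  define d where "d = Inf (Q ` V)"
  have bdd: "bdd_below (Q ` V)"
    by (intro bdd_belowI[of _ 0]) (auto simp: Q_def)
  have d: "d \<le> Q v" if "v \<in> V" for v
    unfolding d_def using bdd that by (intro cInf_lower) auto
  have "\<exists>v\<in>V. Q v < d + 1 / (real k + 1)" for k
    using cInf_lessD[of "Q ` V" "d + 1 / (real k + 1)"] V by (auto simp: d_def)
  then obtain X where XV: "\<And>k. X k \<in> V" and XQ: "\<And>k. Q (X k) < d + 1 / (real k + 1)" by metis
  have XH: "X k \<in> H" for k using XV V by blast
  have eps: "(\<lambda>k. 1 / (real k + 1)) \<longlonglongrightarrow> 0" using LIMSEQ_inverse_real_of_nat by (simp add: inverse_eq_divide add.commute)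
  \<comment> \<open>The midpoint of \<open>X p\<close> and \<open>X q\<close> lies in
    \<open>V\<close>, so its squared distance to \<open>f\<close> is at least \<open>d\<close>; the
    parallelogram law then leaves only the two excesses over \<open>d\<close>.\<close>
  have X2: "(hnorm ip (\<lambda>z. X p z - X q z))\<^sup>2 \<le> 2 / (real p + 1) + 2 / (real q + 1)" for p q
  proof -
    have "(hnorm ip (\<lambda>z. (f z - X p z) - (f z - X q z)))\<^sup>2 + (hnorm ip (\<lambda>z. (f z - X p z) + (f z - X q z)))\<^sup>2
        = 2 * Q (X p) + 2 * Q (X q)"
      unfolding Q_def by (rule parallelogram) (auto simp: f XH diff_mem)
    moreover have "(\<lambda>z. (f z - X p z) - (f z - X q z)) = (\<lambda>z. X q z - X p z)" by simp
    moreover have "(\<lambda>z. (f z - X p z) + (f z - X q z)) = (\<lambda>z. 2 * (f z - (1/2) * (X p z + X q z)))"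
      by (simp add: algebra_simps)
    moreover have "(hnorm ip (\<lambda>z. 2 * (f z - (1/2) * (X p z + X q z))))\<^sup>2 = 4 * Q (\<lambda>z. (1/2) * (X p z + X q z))"
      unfolding Q_def using hnorm_scale_sq[OF diff_mem[OF f scale_mem[OF add_mem[OF XH XH]]], of 2 "1/2" p q]
      by simp
    moreover have "d \<le> Q (\<lambda>z. (1/2) * (X p z + X q z))"
      by (intro d scale add XV)
    moreover have "(hnorm ip (\<lambda>z. X p z - X q z))\<^sup>2 = (hnorm ip (\<lambda>z. X q z - X p z))\<^sup>2"
      using hnorm_scale_sq[OF diff_mem[OF XH XH], of "-1" q p] by simp
    ultimately show ?thesis using XQ[of p] XQ[of q] by simp
  qed
  obtain s where s: "converges X s"
  proof (rule complete_sq[OF XH])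
    fix e :: real assume "e > 0"
    then have "\<forall>\<^sub>F k in sequentially. 1 / (real k + 1) < e / 4"
      by (intro order_tendstoD(2)[OF eps]) simp
    then obtain N where N: "\<forall>k\<ge>N. 1 / (real k + 1) < e / 4"
      by (auto simp: eventually_sequentially)
    have "(hnorm ip (\<lambda>z. X p z - X q z))\<^sup>2 < e" if "p \<ge> N" "q \<ge> N" for p q
      using X2[of p q] N[rule_format, OF that(1)] N[rule_format, OF that(2)] by simp
    then show "\<exists>N. \<forall>p\<ge>N. \<forall>q\<ge>N. (hnorm ip (\<lambda>z. X p z - X q z))\<^sup>2 < e" by blast
  qed (use that in blast)
  have "(\<lambda>z. f z - s z) = (\<lambda>z. 0)"
  proof (rule total)
    show "(\<lambda>z. f z - s z) \<in> H" using f convergesD(2)[OF s] by (rule diff_mem)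
    fix g assume g: "g \<in> V"
    then have gH: "g \<in> H" using V by blast
    \<comment> \<open>Moving \<open>X k\<close> along \<open>g\<close> stays in \<open>V\<close>, so
      \<open>d\<close> also bounds the squared distance from \<open>f - X k\<close> to any multiple
      of \<open>g\<close>; the factor \<open>Q (X k) - d\<close> tends to 0.\<close>
    have bound: "(cmod (ip f g - ip (X k) g))\<^sup>2 \<le> (hnorm ip g)\<^sup>2 * (1 / (real k + 1))" for k
    proof -
      have "(cmod (ip (\<lambda>z. f z - X k z) g))\<^sup>2 \<le> (hnorm ip g)\<^sup>2 * (Q (X k) - d)"
        unfolding Q_def
      proof (rule distance_to_line)
        fix c
        show "d \<le> (hnorm ip (\<lambda>z. f z - X k z - c * g z))\<^sup>2"
          using d[OF add[OF XV scale[OF g]], of k c] by (simp add: Q_def algebra_simps)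
      qed (auto simp: f XH diff_mem gH)
      also have "\<dots> \<le> (hnorm ip g)\<^sup>2 * (1 / (real k + 1))"
        using XQ[of k] by (intro mult_left_mono) auto
      finally show ?thesis by (simp add: ip_diff_left f XH gH)
    qed
    have "(\<lambda>k. (cmod (ip f g - ip (X k) g))\<^sup>2) \<longlonglongrightarrow> (cmod (ip f g - ip s g))\<^sup>2"
      by (intro tendsto_intros converges_ip[OF s gH])
    moreover have "(\<lambda>k. (hnorm ip g)\<^sup>2 * (1 / (real k + 1))) \<longlonglongrightarrow> (hnorm ip g)\<^sup>2 * 0"
      by (intro tendsto_intros eps)
    ultimately have "(cmod (ip f g - ip s g))\<^sup>2 \<le> (hnorm ip g)\<^sup>2 * 0"
      using bound by (intro LIMSEQ_le) auto
    then show "ip (\<lambda>z. f z - s z) g = 0"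
      using f convergesD(2)[OF s] gH by (simp add: ip_diff_left)
  qed
  then have "f = s" by (simp add: fun_eq_iff)
  then show ?thesis using that XV s by blast
qed

end

section \<open>Orthogonal expansions\<close>

locale orthogonal_system = hilbert_functions \<Omega> H ip
  for \<Omega> :: "(complex ^ 'm::finite) set" and H ip +
  fixes e :: "'i \<Rightarrow> complex ^ 'm \<Rightarrow> complex" and I :: "'i set" and F :: "nat \<Rightarrow> 'i set"
  assumes e_mem: "n \<in> I \<Longrightarrow> e n \<in> H"
    and e_nonzero: "n \<in> I \<Longrightarrow> e n \<noteq> (\<lambda>z. 0)"
    and e_orth: "\<lbrakk>n \<in> I; k \<in> I; n \<noteq> k\<rbrakk> \<Longrightarrow> ip (e n) (e k) = 0"
    and F_finite: "finite (F p)" and F_incseq: "incseq F" and F_exhausts: "(\<Union>p. F p) = I"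
begin

definition weight :: "'i \<Rightarrow> real" where "weight n = (hnorm ip (e n))\<^sup>2"

definition psum :: "'i set \<Rightarrow> ('i \<Rightarrow> complex) \<Rightarrow> complex ^ 'm \<Rightarrow> complex" where
  "psum A d = (\<lambda>z. \<Sum>n\<in>A. d n * e n z)"

text \<open>The \<open>e n\<close> are not normalised. Dividing by the squared norm makes
  \<open>coef f n\<close> the factor in front of \<open>e n\<close>, which for monomials is a Taylor
  coefficient.\<close>

definition coef :: "(complex ^ 'm \<Rightarrow> complex) \<Rightarrow> 'i \<Rightarrow> complex" where
  "coef f n = ip f (e n) / weight n"

lemma weight_pos: "n \<in> I \<Longrightarrow> weight n > 0"
  using hnorm_pos[OF e_mem e_nonzero, of n] by (simp add: weight_def)

lemma F_subset: "F k \<subseteq> I"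
  using F_exhausts by blast

lemma eventually_mem_F: "n \<in> I \<Longrightarrow> \<forall>\<^sub>F k in sequentially. n \<in> F k"
proof -
  assume "n \<in> I"
  then obtain N where "n \<in> F N" using F_exhausts by blast
  then show ?thesis
    using incseqD[OF F_incseq] by (auto simp: eventually_sequentially)
qed

text \<open>Completeness and \<open>converges\<close> speak of sequences, \<open>has_sum\<close> of
  unordered sums. Along the exhaustion \<open>F\<close> the two kinds of limit can be
  compared.\<close>

lemma filterlim_F: "filterlim F (finite_subsets_at_top I) sequentially"
  unfolding filterlim_finite_subsets_at_top
proof (intro allI impI)
  fix X assume X: "finite X \<and> X \<subseteq> I"
  then have "\<forall>\<^sub>F k in sequentially. \<forall>n\<in>X. n \<in> F k"
    by (intro eventually_ball_finite ballI eventually_mem_F) auto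
  then show "\<forall>\<^sub>F k in sequentially. finite (F k) \<and> X \<subseteq> F k \<and> F k \<subseteq> I"
    by eventually_elim (use F_finite F_subset in auto)
qed

lemma psum_mem: "A \<subseteq> I \<Longrightarrow> psum A d \<in> H"
  unfolding psum_def by (intro sum_mem scale_mem e_mem) auto

lemma ip_psum_left: "\<lbrakk>A \<subseteq> I; g \<in> H\<rbrakk> \<Longrightarrow> ip (psum A d) g = (\<Sum>n\<in>A. d n * ip (e n) g)"
  unfolding psum_def
  by (subst ip_sum_left) (auto intro!: sum.cong scale_mem e_mem ip_scale_left)

lemma ip_psum_e:
  assumes "finite A" "A \<subseteq> I" "k \<in> I"
  shows "ip (psum A d) (e k) = (if k \<in> A then d k * weight k else 0)"
proof -
  have "ip (psum A d) (e k) = (\<Sum>n\<in>A. if n = k then d k * weight k else 0)"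
    unfolding ip_psum_left[OF assms(2) e_mem[OF assms(3)]]
    using assms by (intro sum.cong) (auto simp: e_mem e_orth weight_def ip_self)
  then show ?thesis using assms by simp
qed

lemma ip_psum_psum:
  assumes "finite A" "A \<subseteq> I"
  shows "ip (psum A d) (psum A d) = complex_of_real (\<Sum>n\<in>A. (cmod (d n))\<^sup>2 * weight n)"
proof -
  have "ip (e n) (psum A d) = cnj (d n) * weight n" if "n \<in> A" for n
    using that assms ip_cnj[OF psum_mem e_mem, of A n d] by (auto simp: ip_psum_e)
  then show ?thesis
    using assms
    by (subst ip_psum_left)
       (auto intro!: sum.cong psum_mem simp: complex_norm_square[unfolded of_real_power] mult.assoc)
qed

lemma hnorm_psum_sq:
  "\<lbrakk>finite A; A \<subseteq> I\<rbrakk> \<Longrightarrow> (hnorm ip (psum A d))\<^sup>2 = (\<Sum>n\<in>A. (cmod (d n))\<^sup>2 * weight n)"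
  by (simp add: hnorm_sq psum_mem ip_psum_psum)

text \<open>By orthogonality, the squared distance of two partial sums along \<open>F\<close> is the
  difference of the scalar partial sums \<open>s\<close>, which increase and stay below
  \<open>B\<close>. Continuity of the inner product then reads off the coefficients.\<close>

lemma Riesz_Fischer:
  assumes bound: "\<And>A. \<lbrakk>finite A; A \<subseteq> I\<rbrakk> \<Longrightarrow> (\<Sum>n\<in>A. (cmod (d n))\<^sup>2 * weight n) \<le> B"
  obtains h where "converges (\<lambda>k. psum (F k) d) h" "\<And>n. n \<in> I \<Longrightarrow> coef h n = d n"
proof -
  define s where "s k = (\<Sum>n\<in>F k. (cmod (d n))\<^sup>2 * weight n)" for k
  have "incseq s"
    unfolding incseq_def s_def
    using incseqD[OF F_incseq] by (auto intro!: sum_mono2 F_finite simp: weight_def)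
  then have "Cauchy s"
    using bound[OF F_finite F_subset] incseq_convergent[of s B]
    by (metis LIMSEQ_imp_Cauchy s_def)
  have diff: "(hnorm ip (\<lambda>z. psum (F p) d z - psum (F q) d z))\<^sup>2 \<le> \<bar>s p - s q\<bar>" if "p \<le> q" for p q
  proof -
    have pq: "F p \<subseteq> F q" using incseqD[OF F_incseq that] .
    have "psum (F p) d z - psum (F q) d z = (-1) * psum (F q - F p) d z" for z
      unfolding psum_def sum_diff[OF F_finite pq] by simp
    then have "(hnorm ip (\<lambda>z. psum (F p) d z - psum (F q) d z))\<^sup>2 = (hnorm ip (psum (F q - F p) d))\<^sup>2"
      using hnorm_scale_sq[OF psum_mem[of "F q - F p" d], of "-1"] F_subset by auto
    also have "\<dots> = s q - s p"
      using F_finite F_subset by (subst hnorm_psum_sq) (auto simp: s_def sum_diff[OF F_finite pq])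
    finally show ?thesis by simp
  qed
  obtain h where h: "converges (\<lambda>k. psum (F k) d) h"
    by (rule complete_Cauchy[OF _ \<open>Cauchy s\<close> diff]) (use F_subset psum_mem in blast)+
  have "coef h n = d n" if n: "n \<in> I" for n
  proof -
    have "(\<lambda>k. ip (psum (F k) d) (e n)) \<longlonglongrightarrow> ip h (e n)"
      by (rule converges_ip[OF h e_mem[OF n]])
    moreover have "(\<lambda>k. ip (psum (F k) d) (e n)) \<longlonglongrightarrow> d n * weight n"
      by (rule tendsto_eventually, rule eventually_mono[OF eventually_mem_F[OF n]])
         (simp add: ip_psum_e F_finite F_subset n)
    ultimately have "ip h (e n) = d n * weight n" by (rule LIMSEQ_unique)
    then show ?thesis using weight_pos[OF n] by (simp add: coef_def)
  qed
  then show ?thesis using that h by blast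
qed

lemma ip_eq_coef: "n \<in> I \<Longrightarrow> ip f (e n) = coef f n * weight n"
  using weight_pos[of n] by (simp add: coef_def)

text \<open>Expand the nonnegative squared norm of \<open>psum A (coef f) - f\<close>: both the
  squared norm of the partial sum and its product with \<open>f\<close> equal the left-hand
  side.\<close>

lemma Bessel:
  assumes f: "f \<in> H" and A: "finite A" "A \<subseteq> I"
  shows "(\<Sum>n\<in>A. (cmod (coef f n))\<^sup>2 * weight n) \<le> (hnorm ip f)\<^sup>2"
proof -
  have "ip (e n) f = cnj (coef f n) * weight n" if "n \<in> A" for n
    using that A ip_cnj[OF f e_mem, of n] by (auto simp: ip_eq_coef)
  then have "ip (psum A (coef f)) f = complex_of_real (\<Sum>n\<in>A. (cmod (coef f n))\<^sup>2 * weight n)"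
    using A f
    by (subst ip_psum_left)
       (auto intro!: sum.cong simp: complex_norm_square[unfolded of_real_power] mult.assoc)
  moreover have "0 \<le> (hnorm ip (\<lambda>z. psum A (coef f) z - f z))\<^sup>2" by simp
  ultimately show ?thesis
    using A f by (simp add: hnorm_diff_sq psum_mem hnorm_psum_sq del: zero_le_power2)
qed

context
  assumes total: "\<And>f. \<lbrakk>f \<in> H; \<And>n. n \<in> I \<Longrightarrow> ip f (e n) = 0\<rbrakk> \<Longrightarrow> f = (\<lambda>z. 0)"
begin

text \<open>\<open>Riesz_Fischer\<close> yields a limit with the coefficients of \<open>f\<close>;
  the difference is orthogonal to every \<open>e n\<close>.\<close>

lemma psum_coef_converges:
  assumes f: "f \<in> H"
  shows "converges (\<lambda>k. psum (F k) (coef f)) f"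
proof -
  obtain h where h: "converges (\<lambda>k. psum (F k) (coef f)) h" "\<And>n. n \<in> I \<Longrightarrow> coef h n = coef f n"
    using Riesz_Fischer[OF Bessel[OF f]] by blast
  have "(\<lambda>z. f z - h z) = (\<lambda>z. 0)"
    using f convergesD(2)[OF h(1)] h(2)
    by (intro total diff_mem) (auto simp: ip_diff_left e_mem ip_eq_coef)
  then have "f = h" by (simp add: fun_eq_iff)
  then show ?thesis using h(1) by simp
qed

text \<open>Summability follows by bounding a product of coefficients by the sum of their squares
  and applying Bessel to both functions; the value is then computed along \<open>F\<close>. Taking
  \<open>g\<close> to be a kernel function gives pointwise expansions, taking \<open>g = f\<close>
  gives the norm.\<close>

lemma Parseval:
  assumes f: "f \<in> H" and g: "g \<in> H"
  shows "((\<lambda>n. coef f n * ip (e n) g) has_sum ip f g) I"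
proof -
  have sq: "(\<lambda>n. (cmod (coef h n))\<^sup>2 * weight n) summable_on I" if "h \<in> H" for h
    by (rule nonneg_bdd_above_summable_on)
       (auto intro!: bdd_aboveI[of _ "(hnorm ip h)\<^sup>2"] Bessel that simp: less_imp_le weight_pos)
  have "norm (coef f n * ip (e n) g) \<le> (cmod (coef f n))\<^sup>2 * weight n + (cmod (coef g n))\<^sup>2 * weight n"
    if n: "n \<in> I" for n
  proof -
    have "norm (coef f n * ip (e n) g) = cmod (coef f n) * cmod (coef g n) * weight n"
      using ip_cnj[OF g e_mem[OF n]] weight_pos[OF n] n by (simp add: ip_eq_coef norm_mult)
    also have "cmod (coef f n) * cmod (coef g n) \<le> (cmod (coef f n))\<^sup>2 + (cmod (coef g n))\<^sup>2"
      using sum_squares_bound[of "cmod (coef f n)" "cmod (coef g n)"]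
        mult_nonneg_nonneg[OF norm_ge_zero[of "coef f n"] norm_ge_zero[of "coef g n"]] by linarith
    finally show ?thesis using weight_pos[OF n] by (simp add: distrib_right)
  qed
  then have "(\<lambda>n. norm (coef f n * ip (e n) g)) summable_on I"
    by (intro summable_on_comparison_test[OF summable_on_add[OF sq[OF f] sq[OF g]]]) auto
  then have "(\<lambda>n. coef f n * ip (e n) g) summable_on I" by (rule abs_summable_summable)
  then obtain S where S: "((\<lambda>n. coef f n * ip (e n) g) has_sum S) I"
    by (auto simp: summable_on_def)
  then have "(\<lambda>k. \<Sum>n\<in>F k. coef f n * ip (e n) g) \<longlonglongrightarrow> S"
    unfolding has_sum_def by (rule filterlim_compose[OF _ filterlim_F])
  moreover have "(\<lambda>k. \<Sum>n\<in>F k. coef f n * ip (e n) g) \<longlonglongrightarrow> ip f g"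
    using converges_ip[OF psum_coef_converges[OF f] g] by (simp add: ip_psum_left F_subset g)
  ultimately show ?thesis using S LIMSEQ_unique by blast
qed

end

end

section \<open>Holomorphic functions on Reinhardt domains\<close>

definition polydisc :: "real \<Rightarrow> (complex ^ 'm::finite) set" where
  "polydisc r = {z. \<forall>i. cmod (z $ i) < r}"

definition upd :: "complex ^ 'm::finite \<Rightarrow> 'm \<Rightarrow> complex \<Rightarrow> complex ^ 'm" where
  "upd z j x = (\<chi> i. if i = j then x else z $ i)"

definition rot :: "'m::finite \<Rightarrow> complex \<Rightarrow> complex ^ 'm" where
  "rot j \<theta> = (\<chi> i. if i = j then \<theta> else 1)"

text \<open>Orders that are powers of 2 give groups each contained in the next. Their union is
  infinite, which serves both the identity theorem and the separation of exponents.\<close>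

definition dyadic_roots :: "nat \<Rightarrow> complex set" where
  "dyadic_roots p = {\<theta>. \<theta> ^ (2 ^ p) = 1}"

lemma card_dyadic_roots: "card (dyadic_roots p) = 2 ^ p"
  by (simp add: dyadic_roots_def card_roots_unity_eq)

lemma dyadic_roots_norm: "\<theta> \<in> dyadic_roots p \<Longrightarrow> cmod \<theta> = 1"
  using power_eq_imp_eq_base[of "cmod \<theta>" "2 ^ p" 1] by (simp add: dyadic_roots_def flip: norm_power)

lemma dyadic_roots_mult: "\<lbrakk>\<theta> \<in> dyadic_roots p; \<eta> \<in> dyadic_roots p\<rbrakk> \<Longrightarrow> \<theta> * \<eta> \<in> dyadic_roots p"
  by (simp add: dyadic_roots_def power_mult_distrib)

lemma dyadic_roots_mono: "p \<le> q \<Longrightarrow> dyadic_roots p \<subseteq> dyadic_roots q"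
  by (auto simp: dyadic_roots_def power_mult dest!: le_imp_power_dvd[of p q "2::nat"])

lemma cnj_mult_self_eq_1: "cmod \<theta> = 1 \<Longrightarrow> cnj \<theta> * \<theta> = 1"
  using complex_norm_square[of \<theta>] by (simp add: mult.commute)

lemma dyadic_roots_cnj: "\<theta> \<in> dyadic_roots p \<Longrightarrow> cnj \<theta> \<in> dyadic_roots p"
  by (auto simp: dyadic_roots_def simp flip: complex_cnj_power)

lemma infinite_dyadic_roots: "infinite (\<Union>p. dyadic_roots p)"
proof
  assume fin: "finite (\<Union>p. dyadic_roots p)"
  define N where "N = card (\<Union>p. dyadic_roots p)"
  have "2 ^ N \<le> N"
    using card_mono[OF fin, of "dyadic_roots N"] by (auto simp: card_dyadic_roots N_def)
  then show False using less_exp[of N] by simp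
qed

lemma torus_rot: "cmod \<theta> = 1 \<Longrightarrow> torus (rot j \<theta>)"
  by (simp add: torus_def rot_def)

lemma tmult_rot_comm: "tmult (rot i \<theta>) (tmult (rot j \<eta>) z) = tmult (rot j \<eta>) (tmult (rot i \<theta>) z)"
  by (simp add: tmult_def vec_eq_iff)

lemma tmult_rot_rot: "tmult (rot j \<theta>) (tmult (rot j \<eta>) z) = tmult (rot j (\<theta> * \<eta>)) z"
  by (simp add: tmult_def rot_def vec_eq_iff)

lemma tmult_rot_upd: "tmult (rot j \<theta>) (upd z j x) = upd z j (\<theta> * x)"
  by (simp add: tmult_def rot_def upd_def vec_eq_iff)

lemma zpow_tmult: "zpow (tmult a z) n = zpow a n * zpow z n"
  by (simp add: zpow_def tmult_def power_mult_distrib prod.distrib)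

lemma zpow_rot: "zpow (rot j \<theta>) n = \<theta> ^ n j"
proof -
  have "zpow (rot j \<theta>) n = (\<Prod>i\<in>UNIV. if i = j then \<theta> ^ n i else 1)"
    unfolding zpow_def by (intro prod.cong) (auto simp: rot_def)
  then show ?thesis by simp
qed

lemma zpow_nonzero: "(\<And>i. z $ i \<noteq> 0) \<Longrightarrow> zpow z n \<noteq> 0"
  by (simp add: zpow_def)

lemma zpow_Suc: "zpow z (n(j := n j + 1)) = z $ j * zpow z n"
proof -
  have "zpow z (n(j := n j + 1)) = (\<Prod>i\<in>UNIV. (if i = j then z $ i else 1) * (z $ i) ^ n i)"
    unfolding zpow_def by (intro prod.cong) auto
  then show ?thesis by (simp add: prod.distrib zpow_def)
qed

lemma open_polydisc: "open (polydisc r :: (complex ^ 'a::finite) set)"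
proof -
  have "polydisc r = (\<Inter>i::'a. {z :: complex ^ 'a. cmod (z $ i) < r})" by (auto simp: polydisc_def)
  moreover have "open (\<Inter>i::'a. {z :: complex ^ 'a. cmod (z $ i) < r})"
    by (intro open_INT finite ballI open_Collect_less continuous_intros)
  ultimately show ?thesis by simp
qed

lemma polydisc_subset:
  assumes "open \<Omega>" "0 \<in> \<Omega>"
  obtains r where "r > 0" "polydisc r \<subseteq> (\<Omega> :: (complex ^ 'm::finite) set)"
proof -
  obtain e where e: "e > 0" "ball 0 e \<subseteq> \<Omega>" using assms open_contains_ball by blast
  \<comment> \<open>The norm is at most the sum of the \<open>CARD('m)\<close> coordinate moduli,
    each below \<open>r\<close>.\<close>
  define r where "r = e / CARD('m)"
  have "z \<in> ball 0 e" if "z \<in> polydisc r" for z :: "complex ^ 'm"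
  proof -
    have "norm z \<le> (\<Sum>i\<in>UNIV. cmod (z $ i))"
      unfolding norm_vec_def by (rule L2_set_le_sum) simp
    also have "\<dots> < (\<Sum>i\<in>(UNIV::'m set). r)"
      using that by (intro sum_strict_mono) (auto simp: polydisc_def)
    finally show ?thesis by (simp add: r_def)
  qed
  then have "polydisc r \<subseteq> \<Omega>" using e by blast
  then show ?thesis using that[of r] e by (simp add: r_def)
qed

text \<open>A sample point with no zero coordinate, so that no monomial vanishes there.\<close>

lemma diag_mem_polydisc: "0 < r \<Longrightarrow> (\<chi> i. complex_of_real (r / 2)) \<in> polydisc r"
  by (simp add: polydisc_def)

lemma upd_mem_polydisc: "\<lbrakk>z \<in> polydisc r; cmod x < r\<rbrakk> \<Longrightarrow> upd z j x \<in> polydisc r"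
  by (simp add: polydisc_def upd_def)

section \<open>Holomorphy in several variables, identity theorem, homogeneous functions\<close>

lemma holo_on_subset: "\<lbrakk>holo_on \<Omega> f; U \<subseteq> \<Omega>\<rbrakk> \<Longrightarrow> holo_on U f"
  by (auto simp: holo_on_def)

lemma holo_on_cong: "\<lbrakk>holo_on \<Omega> f; open \<Omega>; \<And>z. z \<in> \<Omega> \<Longrightarrow> f z = g z\<rbrakk> \<Longrightarrow> holo_on \<Omega> g"
  unfolding holo_on_def by (metis has_derivative_transform_within_open)

lemma holo_on_diff:
  assumes "holo_on \<Omega> f" "holo_on \<Omega> g"
  shows "holo_on \<Omega> (\<lambda>z. f z - g z)"
  unfolding holo_on_def
proof
  fix z assume "z \<in> \<Omega>"
  then obtain f' g' where "(f has_derivative f') (at z)" "\<forall>c v. f' (c *s v) = c * f' v"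
    "(g has_derivative g') (at z)" "\<forall>c v. g' (c *s v) = c * g' v"
    using assms unfolding holo_on_def by blast
  then show "\<exists>h'. ((\<lambda>z. f z - g z) has_derivative h') (at z) \<and> (\<forall>c v. h' (c *s v) = c * h' v)"
    by (intro exI[of _ "\<lambda>v. f' v - g' v"]) (auto intro!: has_derivative_diff simp: algebra_simps)
qed

lemma holo_on_coord_mult:
  assumes "holo_on \<Omega> f"
  shows "holo_on \<Omega> (\<lambda>z. z $ j * f z)"
  unfolding holo_on_def
proof
  fix z assume "z \<in> \<Omega>"
  then obtain f' where f': "(f has_derivative f') (at z)" "\<forall>c v. f' (c *s v) = c * f' v"
    using assms unfolding holo_on_def by blast
  have "((\<lambda>z. z $ j) has_derivative (\<lambda>v. v $ j)) (at z)"
    by (intro bounded_linear_imp_has_derivative bounded_linear_vec_nth)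
  from has_derivative_mult[OF this f'(1)]
  show "\<exists>h'. ((\<lambda>z. z $ j * f z) has_derivative h') (at z) \<and> (\<forall>c v. h' (c *s v) = c * h' v)"
    by (intro exI conjI, assumption) (auto simp: f'(2) algebra_simps)
qed

lemma holo_on_const: "holo_on \<Omega> (\<lambda>z. c)"
  unfolding holo_on_def by (intro ballI exI[of _ "\<lambda>v. 0"]) auto

lemma holo_on_cmult:
  assumes "holo_on \<Omega> f"
  shows "holo_on \<Omega> (\<lambda>z. c * f z)"
  unfolding holo_on_def
proof
  fix z assume "z \<in> \<Omega>"
  then obtain f' where f': "(f has_derivative f') (at z)" "\<forall>c v. f' (c *s v) = c * f' v"
    using assms unfolding holo_on_def by blast
  then show "\<exists>h'. ((\<lambda>z. c * f z) has_derivative h') (at z) \<and> (\<forall>a v. h' (a *s v) = a * h' v)"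
    by (intro exI[of _ "\<lambda>v. c * f' v"]) (auto intro!: has_derivative_mult_right)
qed

lemma holo_on_zpow: "holo_on \<Omega> (\<lambda>z. zpow z n)"
proof -
  have "holo_on \<Omega> (\<lambda>z. \<Prod>i\<in>S. (z $ i) ^ n i)" if "finite S" for S
    using that
  proof induction
    case (insert j S)
    have "holo_on \<Omega> (\<lambda>z. (z $ j) ^ k * (\<Prod>i\<in>S. (z $ i) ^ n i))" for k
    proof (induction k)
      case (Suc k)
      from holo_on_coord_mult[OF this, of j] show ?case by (simp add: mult.assoc)
    qed (simp add: insert.IH)
    then show ?case using insert.hyps by simp
  qed (simp add: holo_on_const)
  then show ?thesis by (simp add: zpow_def)
qed

text \<open>One-variable theory enters through complex lines: by complex linearity, the derivative
  along the line is multiplication by the number \<open>f' b\<close>.\<close>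

lemma holo_on_line:
  assumes f: "holo_on \<Omega> f" and D: "open D" and line: "\<And>x. x \<in> D \<Longrightarrow> a + x *s b \<in> \<Omega>"
  shows "(\<lambda>x. f (a + x *s b)) holomorphic_on D"
  unfolding holomorphic_on_open[OF D]
proof
  fix x assume "x \<in> D"
  then obtain f' where f': "(f has_derivative f') (at (a + x *s b))" "\<And>c v. f' (c *s v) = c * f' v"
    using f line unfolding holo_on_def by blast
  have "linear (\<lambda>x::complex. x *s b)"
    by (rule linearI) (simp_all add: vec_eq_iff algebra_simps)
  then have "((\<lambda>x. x *s b) has_derivative (\<lambda>x. x *s b)) (at x)"
    by (intro bounded_linear_imp_has_derivative) (simp add: linear_linear)
  then have "((\<lambda>x. a + x *s b) has_derivative (\<lambda>x. x *s b)) (at x)"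
    by (auto intro: derivative_eq_intros)
  from diff_chain_at[OF this f'(1)]
  have "((\<lambda>x. f (a + x *s b)) has_derivative (\<lambda>y. f' b * y)) (at x)"
    by (simp add: o_def f'(2) mult.commute)
  then show "\<exists>d. ((\<lambda>x. f (a + x *s b)) has_field_derivative d) (at x)"
    unfolding has_field_derivative_def by blast
qed

lemma continuous_line: "continuous_on D (\<lambda>x::complex. a + x *s (b :: complex ^ 'm::finite))"
proof -
  have "linear (\<lambda>x::complex. x *s b)"
    by (rule linearI) (simp_all add: vec_eq_iff algebra_simps)
  then show ?thesis
    by (intro continuous_intros linear_continuous_on) (simp add: linear_linear)
qed

lemma holo_on_slice:
  assumes f: "holo_on (polydisc r) f" and z: "z \<in> polydisc r"
  shows "(\<lambda>x. f (upd z j x)) holomorphic_on ball 0 r"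
proof -
  have upd: "upd z j x = upd z j 0 + x *s axis j 1" for x
    by (simp add: upd_def axis_def vec_eq_iff)
  have "(\<lambda>x. f (upd z j 0 + x *s axis j 1)) holomorphic_on ball 0 r"
    by (rule holo_on_line[OF f]) (use z in \<open>auto simp: upd[symmetric] intro: upd_mem_polydisc\<close>)
  then show ?thesis by (simp add: upd[symmetric])
qed

text \<open>The interior \<open>V\<close> of the zero set is relatively closed. Near a limit point
  \<open>y\<close>, take \<open>z1\<close> in \<open>V\<close> inside a ball around \<open>y\<close>
  and join it to any \<open>w\<close> of the ball by a complex line. The parameters for which the
  line stays in the ball form a convex set \<open>D\<close>, on which the one-variable identity
  theorem carries the zeros from near \<open>z1\<close> to \<open>w\<close>. Connectedness of
  \<open>\<Omega>\<close> finishes.\<close>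

lemma holo_on_eq_0_if_open:
  fixes f :: "complex ^ 'm::finite \<Rightarrow> complex"
  assumes f: "holo_on \<Omega> f" and \<Omega>: "open \<Omega>" "connected \<Omega>"
    and U: "open U" "U \<noteq> {}" "U \<subseteq> \<Omega>" "\<And>z. z \<in> U \<Longrightarrow> f z = 0" and z: "z \<in> \<Omega>"
  shows "f z = 0"
proof -
  define V where "V = interior {z \<in> \<Omega>. f z = 0}"
  have V: "open V" "V \<subseteq> \<Omega>" "\<And>z. z \<in> V \<Longrightarrow> f z = 0"
    using interior_subset by (auto simp: V_def)
  have "U \<subseteq> V" unfolding V_def using U by (intro interior_maximal) auto
  have closed: "y \<in> V" if y: "y \<in> \<Omega>" "y \<in> closure V" for y
  proof -
    obtain r where r: "r > 0" "ball y r \<subseteq> \<Omega>" using y \<Omega> open_contains_ball by blast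
    then obtain z1 where z1: "z1 \<in> V" "z1 \<in> ball y r"
      using y(2) by (metis closure_approachable dist_commute mem_ball)
    have "f w = 0" if w: "w \<in> ball y r" for w
    proof -
      define L where "L x = z1 + x *s (w - z1)" for x
      have affine: "L ((1 - u) *\<^sub>R x + u *\<^sub>R x') = (1 - u) *\<^sub>R L x + u *\<^sub>R L x'" for u x x'
        unfolding L_def vec_eq_iff by simp (simp add: scaleR_conv_of_real algebra_simps)
      define D where "D = L -` ball y r"
      have contL: "continuous_on UNIV L" unfolding L_def by (rule continuous_line)
      have "open D" unfolding D_def using contL by (simp add: open_vimage)
      have "convex D"
        unfolding convex_alt D_def vimage_def mem_Collect_eq affine
        using convex_ball[of y r] by (auto simp: convex_alt)
      have "L 0 = z1" "L 1 = w" by (simp_all add: L_def)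
      have fL: "(\<lambda>x. f (L x)) holomorphic_on D"
        unfolding L_def by (rule holo_on_line[OF f \<open>open D\<close>]) (use r in \<open>auto simp: D_def L_def\<close>)
      have "f (L 1) = 0"
      proof (rule analytic_continuation_open[where s = "L -` V \<inter> D" and s' = D and f = "\<lambda>x. f (L x)" and g = "\<lambda>x. 0" and z = 1])
        show "open (L -` V \<inter> D)" using contL V \<open>open D\<close> by (intro open_Int open_vimage)
        show "L -` V \<inter> D \<noteq> {}" using \<open>L 0 = z1\<close> z1 unfolding D_def by auto
        show "connected D" using \<open>convex D\<close> by (rule convex_connected)
        show "1 \<in> D" using \<open>L 1 = w\<close> w by (simp add: D_def)
      qed (use \<open>open D\<close> fL V in auto)
      then show ?thesis using \<open>L 1 = w\<close> by simp
    qed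
    then show "y \<in> V"
      unfolding V_def mem_interior using r by blast
  qed
  have "\<Omega> \<subseteq> V"
  proof (rule ccontr)
    assume "\<not> \<Omega> \<subseteq> V"
    then obtain y where y: "y \<in> \<Omega>" "y \<notin> V" by blast
    have "V \<inter> \<Omega> = {} \<or> (- closure V) \<inter> \<Omega> = {}"
      using \<Omega>(2) V(1)
    proof (rule connectedD)
      show "\<Omega> \<subseteq> V \<union> - closure V" using closed by auto
      show "V \<inter> - closure V \<inter> \<Omega> = {}" using closure_subset by auto
    qed auto
    then show False using y closed \<open>U \<subseteq> V\<close> U V(2) by blast
  qed
  then show ?thesis using V z by blast
qed

lemma holo_on_eq_if_polydisc:
  assumes "holo_on \<Omega> f" "holo_on \<Omega> g" "open \<Omega>" "connected \<Omega>" "r > 0" "polydisc r \<subseteq> \<Omega>"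
    and "\<And>z. z \<in> polydisc r \<Longrightarrow> f z = g z" "z \<in> \<Omega>"
  shows "f z = g z"
proof -
  have "f z - g z = 0"
    by (rule holo_on_eq_0_if_open[OF holo_on_diff[OF assms(1,2)] assms(3,4) open_polydisc _ assms(6)])
       (use assms diag_mem_polydisc in auto)
  then show ?thesis by simp
qed

text \<open>The points \<open>\<theta> * p\<close> form an infinite set on a circle inside the disc,
  so they accumulate there, and \<open>p ^ k * F x - x ^ k * F p\<close> vanishes at all of
  them.\<close>

lemma homogeneous_on_disc:
  assumes F: "F holomorphic_on ball 0 r" and p: "p \<noteq> 0" "cmod p < r"
    and hom: "\<And>q \<theta>. \<theta> \<in> dyadic_roots q \<Longrightarrow> F (\<theta> * p) = \<theta> ^ k * F p"
    and x: "cmod x < r"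
  shows "p ^ k * F x = x ^ k * F p"
proof -
  define U where "U = (\<lambda>\<theta>. \<theta> * p) ` (\<Union>q. dyadic_roots q)"
  have "infinite U"
    unfolding U_def using infinite_dyadic_roots p by (subst finite_image_iff) (auto simp: inj_on_def)
  moreover have "U \<subseteq> sphere 0 (cmod p)"
    using dyadic_roots_norm by (force simp: U_def norm_mult)
  ultimately obtain \<xi> where "\<xi> \<in> sphere 0 (cmod p)" "\<xi> islimpt U"
    using compact_sphere[of 0 "cmod p"] unfolding compact_eq_Bolzano_Weierstrass by blast
  moreover have "U \<subseteq> ball 0 r" using \<open>U \<subseteq> sphere 0 (cmod p)\<close> p by auto
  ultimately have "p ^ k * F x - x ^ k * F p = 0"
  proof (rule_tac analytic_continuation[where S = "ball 0 r" and U = U and \<xi> = \<xi> and f = "\<lambda>x. p ^ k * F x - x ^ k * F p"])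
    show "p ^ k * F y - y ^ k * F p = 0" if "y \<in> U" for y
      using that hom by (auto simp: U_def power_mult_distrib)
  qed (use p x F in \<open>auto intro!: holomorphic_intros\<close>)
  then show ?thesis by simp
qed

text \<open>Near 0, replace the coordinates of \<open>z\<close> one at a time by a fixed nonzero
  \<open>p\<close>: each replacement trades a factor \<open>p ^ n j\<close> for
  \<open>(z $ j) ^ n j\<close>. In the end a single value of \<open>f\<close> is left, and it
  determines \<open>c\<close>.\<close>

lemma homogeneous_imp_monomial:
  fixes f :: "complex ^ 'm::finite \<Rightarrow> complex"
  assumes f: "holo_on \<Omega> f" and \<Omega>: "open \<Omega>" "connected \<Omega>" "0 \<in> \<Omega>"
    and hom: "\<And>j z q \<theta>. \<lbrakk>z \<in> \<Omega>; \<theta> \<in> dyadic_roots q\<rbrakk> \<Longrightarrow> f (tmult (rot j \<theta>) z) = \<theta> ^ n j * f z"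
  obtains c where "\<And>z. z \<in> \<Omega> \<Longrightarrow> f z = c * zpow z n"
proof -
  obtain r where r: "r > 0" "polydisc r \<subseteq> \<Omega>" using polydisc_subset \<Omega> by blast
  define p where "p = complex_of_real (r / 2)"
  have p: "p \<noteq> 0" "cmod p < r" using r by (auto simp: p_def)
  have *: "(\<Prod>i\<in>S. p ^ n i) * f z = (\<Prod>i\<in>S. (z $ i) ^ n i) * f (\<chi> i. if i \<in> S then p else z $ i)"
    if "finite S" "z \<in> polydisc r" for S z
    using that
  proof induction
    case (insert j S)
    define y where "y = (\<chi> i. if i \<in> S then p else z $ i)"
    have y: "y \<in> polydisc r" using insert.prems p by (auto simp: y_def polydisc_def)
    have "p ^ n j * f (upd y j (z $ j)) = (z $ j) ^ n j * f (upd y j p)"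
    proof (rule homogeneous_on_disc[where F = "\<lambda>x. f (upd y j x)" and r = r])
      show "(\<lambda>x. f (upd y j x)) holomorphic_on ball 0 r"
        using holo_on_subset[OF f r(2)] y by (rule holo_on_slice)
      show "f (upd y j (\<theta> * p)) = \<theta> ^ n j * f (upd y j p)" if "\<theta> \<in> dyadic_roots q" for q \<theta>
        using hom[OF _ that, of "upd y j p" j] upd_mem_polydisc[OF y p(2)] r by (auto simp: tmult_rot_upd)
    qed (use p insert.prems in \<open>auto simp: polydisc_def\<close>)
    moreover have "upd y j (z $ j) = y" "upd y j p = (\<chi> i. if i \<in> insert j S then p else z $ i)"
      using insert.hyps by (auto simp: upd_def y_def vec_eq_iff)
    ultimately show ?case
      using insert.IH[OF insert.prems] insert.hyps by (simp add: y_def[symmetric] mult.assoc)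
  qed simp
  define c where "c = f (\<chi> i. p) / (\<Prod>i\<in>UNIV. p ^ n i)"
  have "f z = c * zpow z n" if "z \<in> polydisc r" for z
    using *[OF _ that, of UNIV] p by (simp add: c_def zpow_def field_simps)
  then have "f z = c * zpow z n" if "z \<in> \<Omega>" for z
    using holo_on_eq_if_polydisc[OF f holo_on_cmult[OF holo_on_zpow] \<Omega>(1,2) r _ that] by blast
  then show ?thesis using that by blast
qed

text \<open>The exponent is the order of the zero of \<open>F\<close> at the origin: dividing it out leaves the
  averages of a function that is close to a nonzero constant on a small circle.\<close>
lemma dyadic_averages_bounded_below:
  assumes F: "F holomorphic_on ball 0 r" and x0: "x0 \<in> ball 0 r" "F x0 \<noteq> 0"
  obtains k x \<delta> where "cmod x < r" "\<delta> > 0"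
    "\<And>p. \<delta> \<le> cmod ((\<Sum>\<theta>\<in>dyadic_roots p. cnj \<theta> ^ k * F (\<theta> * x)) / 2 ^ p)"
proof -
  define g where "g = zor_poly F 0"
  define k where "k = nat (zorder F 0)"
  have r: "0 < r" using x0 by (auto intro: le_less_trans[OF norm_ge_zero])
  have "0 \<in> ball 0 r" "\<exists>w\<in>ball 0 r. F w \<noteq> 0" using x0 r by auto
  from conjunct2[OF zorder_exist_zero[OF F open_ball connected_ball this]]
  obtain s where s: "s > 0" "cball (0::complex) s \<subseteq> ball 0 r" "g holomorphic_on cball 0 s"
      and gs: "\<forall>w\<in>cball 0 s. F w = g w * (w - 0) ^ k \<and> g w \<noteq> 0"
    unfolding g_def k_def by blast
  have factor: "F w = g w * w ^ k" "g w \<noteq> 0" if "cmod w \<le> s" for w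
    using gs that by auto
  have g0: "g 0 \<noteq> 0" using factor s(1) by simp
  have "continuous_on (cball 0 s) g" using s(3) by (rule holomorphic_on_imp_continuous_on)
  then obtain d where d: "d > 0" "\<And>w. \<lbrakk>w \<in> cball 0 s; dist w 0 < d\<rbrakk> \<Longrightarrow> dist (g w) (g 0) < cmod (g 0) / 2"
  proof -
    have "0 \<in> cball 0 s" "cmod (g 0) / 2 > 0" using g0 s(1) by auto
    with \<open>continuous_on (cball 0 s) g\<close> show ?thesis
      unfolding continuous_on_iff using that by blast
  qed
  \<comment> \<open>A circle small enough for the factorisation (\<open>cmod x \<le> s\<close>) and
    for \<open>g\<close> to stay within \<open>cmod (g 0) / 2\<close> of \<open>g 0\<close>
    (\<open>cmod x < d\<close>).\<close>
  define x where "x = complex_of_real (min s (d / 2))"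
  have x: "x \<noteq> 0" "cmod x \<le> s" "cmod x < d" using s(1) d(1) by (auto simp: x_def min_def)
  have close: "cmod (g (\<theta> * x) - g 0) \<le> cmod (g 0) / 2" if "\<theta> \<in> dyadic_roots p" for \<theta> p
    using d(2)[of "\<theta> * x"] dyadic_roots_norm[OF that] x by (simp add: norm_mult dist_norm)
  have summand: "cnj \<theta> ^ k * F (\<theta> * x) = x ^ k * g (\<theta> * x)" if "\<theta> \<in> dyadic_roots p" for \<theta> p
  proof -
    have n: "cmod \<theta> = 1" using that by (rule dyadic_roots_norm)
    have "cnj \<theta> ^ k * F (\<theta> * x) = (cnj \<theta> * \<theta>) ^ k * x ^ k * g (\<theta> * x)"
      using factor(1)[of "\<theta> * x"] n x by (simp add: norm_mult power_mult_distrib)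
    then show ?thesis using cnj_mult_self_eq_1[OF n] by simp
  qed
  \<comment> \<open>After cancellation the average is \<open>x ^ k\<close> times the mean of
    \<open>g (\<theta> * x)\<close>, which differs from \<open>g 0\<close> by at most half the
    modulus of \<open>g 0\<close>.\<close>
  define \<delta> where "\<delta> = cmod x ^ k * (cmod (g 0) / 2)"
  have "\<delta> \<le> cmod ((\<Sum>\<theta>\<in>dyadic_roots p. cnj \<theta> ^ k * F (\<theta> * x)) / 2 ^ p)" for p
  proof -
    have "cmod (\<Sum>\<theta>\<in>dyadic_roots p. (g (\<theta> * x) - g 0)) \<le> (\<Sum>\<theta>\<in>dyadic_roots p. cmod (g 0) / 2)"
      using close by (intro sum_norm_le) auto
    then have "cmod ((\<Sum>\<theta>\<in>dyadic_roots p. g (\<theta> * x)) - 2 ^ p * g 0) \<le> 2 ^ p * (cmod (g 0) / 2)"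
      by (simp add: sum_subtractf card_dyadic_roots)
    moreover have "cmod (2 ^ p * g 0) = 2 ^ p * cmod (g 0)" by (simp add: norm_mult norm_power)
    ultimately have "2 ^ p * (cmod (g 0) / 2) \<le> cmod (\<Sum>\<theta>\<in>dyadic_roots p. g (\<theta> * x))"
      using norm_triangle_ineq2[of "2 ^ p * g 0" "2 ^ p * g 0 - (\<Sum>\<theta>\<in>dyadic_roots p. g (\<theta> * x))"]
      by (simp add: norm_minus_commute)
    then have "cmod (g 0) / 2 \<le> cmod (\<Sum>\<theta>\<in>dyadic_roots p. g (\<theta> * x)) / 2 ^ p"
      by (simp add: field_simps)
    then have "\<delta> \<le> cmod x ^ k * (cmod (\<Sum>\<theta>\<in>dyadic_roots p. g (\<theta> * x)) / 2 ^ p)"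
      unfolding \<delta>_def by (intro mult_left_mono) auto
    also have "\<dots> = cmod ((\<Sum>\<theta>\<in>dyadic_roots p. x ^ k * g (\<theta> * x)) / 2 ^ p)"
      by (simp add: sum_distrib_left[symmetric] norm_mult norm_divide norm_power)
    also have "(\<Sum>\<theta>\<in>dyadic_roots p. x ^ k * g (\<theta> * x)) = (\<Sum>\<theta>\<in>dyadic_roots p. cnj \<theta> ^ k * F (\<theta> * x))"
      using summand by (intro sum.cong) auto
    finally show ?thesis .
  qed
  moreover have "\<delta> > 0" using x g0 by (simp add: \<delta>_def)
  moreover have "cmod x < r" using x(2) s(2) by (force simp: subset_iff)
  ultimately show ?thesis using that by blast
qed

section \<open>Uniqueness of power series coefficients\<close>

lemma has_sum_zero_fibre:
  fixes d :: "('m::finite \<Rightarrow> nat) \<Rightarrow> complex"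
  assumes sum0: "\<And>z. z \<in> polydisc r \<Longrightarrow> ((\<lambda>n. d n * zpow z n) has_sum 0) A" and z: "z \<in> polydisc r"
  shows "((\<lambda>n. d n * zpow z n) has_sum 0) {n \<in> A. n j = k}"
proof -
  define u where "u n = d n * zpow z n" for n
  define B where "B k = {n \<in> A. n j = k}" for k
  define s where "s k = infsum u (B k)" for k
  have u: "u summable_on A" unfolding u_def using sum0[OF z] by (rule has_sum_imp_summable)
  have s: "(u has_sum s k) (B k)" for k
    unfolding s_def by (intro has_sum_infsum summable_on_subset_banach[OF u]) (auto simp: B_def)
  \<comment> \<open>Multiplying coordinate \<open>j\<close> by \<open>x\<close> in the unit disc
    keeps the point in the polydisc and turns the sum into a power series in \<open>x\<close> whose
    coefficients \<open>s k\<close> are the sums over the fibres \<open>n j = k\<close>. It vanishes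
    on the disc, so every \<open>s k\<close> is 0.\<close>
  have power: "(\<lambda>k. s k * x ^ k) sums 0" if x: "cmod x < 1" for x
  proof -
    have "tmult (rot j x) z \<in> polydisc r"
      unfolding polydisc_def mem_Collect_eq
    proof
      fix i
      have "cmod (rot j x $ i) \<le> 1" using x by (simp add: rot_def)
      then have "cmod (rot j x $ i) * cmod (z $ i) \<le> 1 * cmod (z $ i)" by (rule mult_right_mono) simp
      then show "cmod (tmult (rot j x) z $ i) < r"
        using z[unfolded polydisc_def, simplified, rule_format, of i] by (simp add: tmult_def norm_mult)
    qed
    from sum0[OF this] have "((\<lambda>n. x ^ n j * u n) has_sum 0) A"
      by (simp add: u_def zpow_tmult zpow_rot mult_ac)
    also have "A = snd ` Sigma UNIV B" by (force simp: B_def)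
    also have "((\<lambda>n. x ^ n j * u n) has_sum 0) (snd ` Sigma UNIV B)
        \<longleftrightarrow> ((\<lambda>(k, n). x ^ k * u n) has_sum 0) (Sigma UNIV B)"
      by (subst has_sum_reindex, force simp: B_def inj_on_def, rule has_sum_cong)
         (auto simp: B_def)
    finally have "((\<lambda>(k, n). x ^ k * u n) has_sum 0) (Sigma UNIV B)" .
    then have "((\<lambda>k. x ^ k * s k) has_sum 0) UNIV"
      by (rule has_sum_Sigma') (auto intro!: has_sum_cmult_right s)
    then show ?thesis by (auto dest!: has_sum_imp_sums simp: mult.commute)
  qed
  \<comment> \<open>Index 0 is read off at \<open>x = 0\<close>, since
    \<open>powser_0_nonzero\<close> is applied at a positive index.\<close>
  have s0: "s 0 = 0" using sums_unique2[OF powser_sums_zero[of s] power[of 0]] by simp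
  have "s k = 0"
  proof (rule ccontr)
    assume "s k \<noteq> 0"
    then have "k > 0" using s0 by (cases k) auto
    obtain e :: real where "e > 0" "\<And>x. x \<in> cball (0::complex) e - {0} \<Longrightarrow> (0::complex) \<noteq> 0"
      using powser_0_nonzero[of 1 0 s "\<lambda>x. 0" k] power \<open>s k \<noteq> 0\<close> \<open>k > 0\<close> by (metis diff_zero zero_less_one)
    from this(2)[of "complex_of_real e"] this(1) show False by simp
  qed
  then show ?thesis using s[of k] unfolding u_def B_def by simp
qed

text \<open>Fixing one exponent at a time shrinks the index set of the vanishing sum until only
  \<open>k\<close> is left; this iteration is why the fibre lemma admits an arbitrary index set
  \<open>A\<close>. At a point without zero coordinates the remaining monomial can be
  cancelled.\<close>

lemma has_sum_zero_imp_coeff_zero: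
  fixes d :: "('m::finite \<Rightarrow> nat) \<Rightarrow> complex"
  assumes r: "r > 0" and sum0: "\<And>z. z \<in> polydisc r \<Longrightarrow> ((\<lambda>n. d n * zpow z n) has_sum 0) UNIV"
  shows "d k = 0"
proof -
  have "((\<lambda>n. d n * zpow z n) has_sum 0) {n. \<forall>j\<in>S. n j = k j}" if "finite S" "z \<in> polydisc r" for S z
    using that
  proof (induction arbitrary: z)
    case (insert j S)
    have "{n. \<forall>j\<in>insert j S. n j = k j} = {n \<in> {n. \<forall>j\<in>S. n j = k j}. n j = k j}" by auto
    then show ?case using has_sum_zero_fibre[OF insert.IH insert.prems] by simp
  qed (use sum0 in simp)
  from this[of UNIV] have "((\<lambda>n. d n * zpow z n) has_sum 0) {k}" if "z \<in> polydisc r" for z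
    using that by (simp add: fun_eq_iff[symmetric])
  from this[OF diag_mem_polydisc[OF r]] have "d k * zpow (\<chi> i. complex_of_real (r / 2)) k = 0"
    by (simp add: has_sum_finite_iff)
  moreover have "zpow (\<chi> i. complex_of_real (r / 2)) k \<noteq> 0"
    using r by (intro zpow_nonzero) auto
  ultimately show ?thesis by simp
qed

lemma taylor0_unique:
  assumes "taylor0 f a" "taylor0 f b"
  shows "a = b"
proof
  fix k
  obtain r where r: "r > 0" "\<And>z. z \<in> polydisc r \<Longrightarrow> ((\<lambda>n. a n * zpow z n) has_sum f z) UNIV"
    using assms(1) unfolding taylor0_def polydisc_def by auto
  obtain s where s: "s > 0" "\<And>z. z \<in> polydisc s \<Longrightarrow> ((\<lambda>n. b n * zpow z n) has_sum f z) UNIV"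
    using assms(2) unfolding taylor0_def polydisc_def by auto
  have "a k - b k = 0"
  proof (rule has_sum_zero_imp_coeff_zero[where d = "\<lambda>n. a n - b n"])
    show "min r s > 0" using r s by simp
    fix z :: "complex ^ 'a" assume "z \<in> polydisc (min r s)"
    then have "z \<in> polydisc r" "z \<in> polydisc s" by (auto simp: polydisc_def)
    from has_sum_add[OF r(2)[OF this(1)] has_sum_cmult_right[OF s(2)[OF this(2)], of "-1"]]
    show "((\<lambda>n. (a n - b n) * zpow z n) has_sum 0) UNIV" by (simp add: algebra_simps)
  qed
  then show "a k = b k" by simp
qed

lemma finite_bounded_multiindices: "finite {n :: 'm::finite \<Rightarrow> nat. \<forall>i. n i \<le> p}"
proof -
  have "{n :: 'm \<Rightarrow> nat. \<forall>i. n i \<le> p} = (\<Pi>\<^sub>E i\<in>UNIV. {..p})" by (auto simp: PiE_def)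
  then show ?thesis by (simp add: finite_PiE)
qed

lemma taylor0I:
  assumes "r > 0" "\<And>z. z \<in> polydisc r \<Longrightarrow> ((\<lambda>n. a n * zpow z n) has_sum f z) UNIV"
  shows "taylor0 f a"
  using assms by (auto simp: taylor0_def polydisc_def)

lemma taylor0E:
  assumes "taylor0 f a"
  obtains r where "r > 0" "\<And>z. z \<in> polydisc r \<Longrightarrow> ((\<lambda>n. a n * zpow z n) has_sum f z) UNIV"
  using assms by (auto simp: taylor0_def polydisc_def)

lemma taylor0_add_scale:
  assumes f: "taylor0 f a" and g: "taylor0 g b"
  shows "taylor0 (\<lambda>z. f z + c * g z) (\<lambda>n. a n + c * b n)"
proof -
  obtain r s where r: "r > 0" "\<And>z. z \<in> polydisc r \<Longrightarrow> ((\<lambda>n. a n * zpow z n) has_sum f z) UNIV"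
    and s: "s > 0" "\<And>z. z \<in> polydisc s \<Longrightarrow> ((\<lambda>n. b n * zpow z n) has_sum g z) UNIV"
    using f g by (metis taylor0E)
  show ?thesis
  proof (rule taylor0I)
    show "min r s > 0" using r s by simp
    fix z :: "complex ^ 'a" assume "z \<in> polydisc (min r s)"
    then have "z \<in> polydisc r" "z \<in> polydisc s" by (auto simp: polydisc_def)
    from has_sum_add[OF r(2)[OF this(1)] has_sum_cmult_right[OF s(2)[OF this(2)], of c]]
    show "((\<lambda>n. (a n + c * b n) * zpow z n) has_sum f z + c * g z) UNIV"
      by (simp add: algebra_simps)
  qed
qed

section \<open>Invariant reproducing kernel spaces\<close>

locale reinhardt_rkhs = hilbert_functions \<Omega> H ip
  for \<Omega> :: "(complex ^ 'm::finite) set" and H ip +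
  fixes \<kappa> :: "complex ^ 'm \<Rightarrow> complex ^ 'm \<Rightarrow> complex"
  assumes reinhardt: "reinhardt_domain \<Omega>" and zero_in_domain: "0 \<in> \<Omega>"
    and kernel: "repr_kernel \<Omega> H ip \<kappa>"
    and coord_mult: "\<forall>j. \<forall>f\<in>H. (\<lambda>z. z $ j * f z) \<in> H"
    and inclusion: "cont_incl_hol \<Omega> H ip"
begin

definition ker :: "complex ^ 'm \<Rightarrow> complex ^ 'm \<Rightarrow> complex" where
  "ker w = (\<lambda>z. if z \<in> \<Omega> then \<kappa> z w else 0)"

abbreviation mono :: "('m \<Rightarrow> nat) \<Rightarrow> complex ^ 'm \<Rightarrow> complex" where
  "mono \<equiv> mono_fn \<Omega>"

lemma domain: "open \<Omega>" "connected \<Omega>"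
  using reinhardt by (auto simp: reinhardt_domain_def)

lemma tmult_mem: "\<lbrakk>torus \<zeta>; z \<in> \<Omega>\<rbrakk> \<Longrightarrow> tmult \<zeta> z \<in> \<Omega>"
  using reinhardt by (auto simp: reinhardt_domain_def)

lemma torus_cnj: "torus \<zeta> \<Longrightarrow> torus (\<chi> i. cnj (\<zeta> $ i))"
  by (simp add: torus_def)

lemma tmult_cnj: "torus \<zeta> \<Longrightarrow> tmult \<zeta> (tmult (\<chi> i. cnj (\<zeta> $ i)) z) = z"
  "torus \<zeta> \<Longrightarrow> tmult (\<chi> i. cnj (\<zeta> $ i)) (tmult \<zeta> z) = z"
  by (simp_all add: tmult_def torus_def vec_eq_iff mult.assoc[symmetric] cnj_mult_self_eq_1
      mult.commute[of "_ $ _" "cnj _"])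

lemma tmult_mem_iff: "torus \<zeta> \<Longrightarrow> tmult \<zeta> z \<in> \<Omega> \<longleftrightarrow> z \<in> \<Omega>"
  using tmult_mem[of \<zeta> z] tmult_mem[OF torus_cnj, of \<zeta> "tmult \<zeta> z"] tmult_cnj(2)[of \<zeta> z] by auto

lemma ker_mem: "w \<in> \<Omega> \<Longrightarrow> ker w \<in> H"
  and reproducing: "\<lbrakk>w \<in> \<Omega>; f \<in> H\<rbrakk> \<Longrightarrow> ip f (ker w) = f w"
  using kernel unfolding repr_kernel_def ker_def by auto

lemma holo: "f \<in> H \<Longrightarrow> holo_on \<Omega> f"
  using inclusion by (auto simp: cont_incl_hol_def)

text \<open>Point evaluation is an inner product with a kernel function, so norm limits are
  pointwise limits.\<close>

lemma converges_pointwise: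
  assumes X: "converges X f"
  shows "(\<lambda>k. X k z) \<longlonglongrightarrow> f z"
proof (cases "z \<in> \<Omega>")
  case True
  then show ?thesis
    using converges_ip[OF X ker_mem[OF True]] convergesD[OF X] by (simp add: reproducing)
next
  case False
  then show ?thesis using convergesD[OF X] by (simp add: vanish_outside)
qed

definition rad :: real where "rad = (SOME r. r > 0 \<and> polydisc r \<subseteq> \<Omega>)"

lemma rad: "rad > 0" "polydisc rad \<subseteq> \<Omega>"
proof -
  have "rad > 0 \<and> polydisc rad \<subseteq> \<Omega>"
    unfolding rad_def using polydisc_subset[OF domain(1) zero_in_domain] by (rule someI2_ex) blast+
  then show "rad > 0" "polydisc rad \<subseteq> \<Omega>" by auto
qed

lemma eq_if_eq_near_0:
  assumes f: "f \<in> H" and g: "holo_on \<Omega> g" "\<And>z. z \<notin> \<Omega> \<Longrightarrow> g z = 0"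
    and r: "r > 0" and eq: "\<And>z. z \<in> polydisc r \<Longrightarrow> z \<in> \<Omega> \<Longrightarrow> f z = g z"
  shows "f = g"
proof
  fix z
  have sub: "polydisc (min r rad) \<subseteq> polydisc r" "polydisc (min r rad) \<subseteq> polydisc rad"
    by (auto simp: polydisc_def)
  show "f z = g z"
  proof (cases "z \<in> \<Omega>")
    case True
    show ?thesis
      by (rule holo_on_eq_if_polydisc[OF holo[OF f] g(1) domain, of "min r rad"])
         (use True sub rad r eq in auto)
  qed (use f g vanish_outside in auto)
qed

lemma holo_mono: "holo_on \<Omega> (mono n)"
  using holo_on_cong[OF holo_on_zpow domain(1), of n "mono n"] by (simp add: mono_fn_def)

lemma mono_nonzero: "mono n \<noteq> (\<lambda>z. 0)"
proof
  assume "mono n = (\<lambda>z. 0)"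
  moreover have "(\<chi> i. complex_of_real (rad / 2)) \<in> \<Omega>" using diag_mem_polydisc rad by blast
  ultimately have "zpow (\<chi> i. complex_of_real (rad / 2)) n = 0"
    by (metis mono_fn_def)
  then show False using zpow_nonzero[of "\<chi> i. complex_of_real (rad / 2)" n] rad by simp
qed

text \<open>Here invariance of \<open>H\<close> under the coordinate functions enters.\<close>

lemma inductive_mono: "inductive_mset {n. mono n \<in> H}"
  unfolding inductive_mset_def
proof (intro ballI allI)
  fix n and j :: 'm assume "n \<in> {n. mono n \<in> H}"
  then have "(\<lambda>z. z $ j * mono n z) \<in> H" using coord_mult by blast
  also have "(\<lambda>z. z $ j * mono n z) = mono (n(j := n j + 1))"
    unfolding mono_fn_def zpow_Suc by auto
  finally show "n(j := n j + 1) \<in> {n. mono n \<in> H}" by simp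
qed

lemma mono_tmult: "torus \<zeta> \<Longrightarrow> mono n (tmult \<zeta> z) = zpow \<zeta> n * mono n z"
  by (simp add: mono_fn_def tmult_mem_iff zpow_tmult)

section \<open>Invariance of the kernel and of the inner product\<close>

lemma P1_imp_P2:
  assumes P1: "P1 \<Omega> \<kappa>"
  shows "P2 H ip"
  unfolding P2_def
proof (intro allI impI)
  fix \<zeta> :: "complex ^ 'm" assume t: "torus \<zeta>"
  define U :: "(complex ^ 'm \<Rightarrow> complex) \<Rightarrow> complex ^ 'm \<Rightarrow> complex" where "U f = (\<lambda>z. f (tmult \<zeta> z))" for f
  define \<zeta>' where "\<zeta>' = (\<chi> i. cnj (\<zeta> $ i))"
  have t': "torus \<zeta>'" "\<And>z. tmult \<zeta> (tmult \<zeta>' z) = z"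
    using t by (auto simp: \<zeta>'_def torus_cnj tmult_cnj)
  \<comment> \<open>\<open>P1\<close> is what makes composition with the rotation send kernel
    functions to kernel functions.\<close>
  have U_ker: "U (ker w) = ker (tmult \<zeta>' w)" if "w \<in> \<Omega>" for w
  proof
    fix z
    have "\<kappa> (tmult \<zeta> z) (tmult \<zeta> (tmult \<zeta>' w)) = \<kappa> z (tmult \<zeta>' w)" if "z \<in> \<Omega>"
      using P1 t that \<open>w \<in> \<Omega>\<close> t' tmult_mem unfolding P1_def by blast
    then show "U (ker w) z = ker (tmult \<zeta>' w) z"
      by (auto simp: U_def ker_def tmult_mem_iff t t')
  qed
  \<comment> \<open>For a general \<open>f\<close> it is not yet known that \<open>U f\<close> lies
    in \<open>H\<close>, hence \<open>S\<close>. Testing \<open>W\<close> against every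
    \<open>g\<close> in \<open>S\<close>, not only against \<open>W\<close>, makes it a linear
    subspace at once and avoids double sums over kernel functions.\<close>
  define S where "S = {f \<in> H. U f \<in> H}"
  define W where "W = {f \<in> S. \<forall>g\<in>S. ip (U f) (U g) = ip f g}"
  have ker_W: "ker w \<in> W" if w: "w \<in> \<Omega>" for w
  proof -
    have w': "tmult \<zeta>' w \<in> \<Omega>" using t' w tmult_mem by blast
    have "ip (U (ker w)) (U g) = ip (ker w) g" if "g \<in> S" for g
    proof -
      have g: "g \<in> H" "U g \<in> H" using that by (auto simp: S_def)
      have "ip (U g) (U (ker w)) = U g (tmult \<zeta>' w)"
        using g w w' by (simp add: U_ker reproducing)
      also have "\<dots> = ip g (ker w)" using g w by (simp add: U_def t' reproducing)
      finally show ?thesis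
        using ip_cnj[OF g(1) ker_mem[OF w]] ip_cnj[OF g(2), of "U (ker w)"] w w'
        by (simp add: U_ker ker_mem)
    qed
    then show ?thesis using w w' by (simp add: W_def S_def U_ker ker_mem)
  qed
  have "f \<in> S" and W_approx: "\<exists>X. (\<forall>k. X k \<in> W) \<and> converges X f \<and> converges (\<lambda>k. U (X k)) (U f)"
    if f: "f \<in> H" for f
  proof -
    obtain X where X: "\<And>k. X k \<in> W" "converges X f"
    proof (rule subspace_dense[of W, OF _ _ _ _ _ f])
      show "W \<subseteq> H" by (auto simp: W_def S_def)
      show "(\<lambda>z. 0) \<in> W"
        by (auto simp: W_def S_def U_def zero_mem ip_zero_left)
      show "(\<lambda>z. f z + g z) \<in> W" if "f \<in> W" "g \<in> W" for f g
        using that by (auto simp: W_def S_def U_def add_mem ip_add_left)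
      show "(\<lambda>z. c * f z) \<in> W" if "f \<in> W" for f c
        using that by (auto simp: W_def S_def U_def scale_mem ip_scale_left)
      show "h = (\<lambda>z. 0)" if h: "h \<in> H" "\<And>g. g \<in> W \<Longrightarrow> ip h g = 0" for h
      proof
        fix z
        show "h z = 0"
          using h(2)[OF ker_W, of z] reproducing[of z h] vanish_outside[of h z] h(1) by auto
      qed
    qed (use that in blast)
    have XH: "X k \<in> H" "U (X k) \<in> H" for k using X(1)[of k] by (auto simp: W_def S_def)
    have U_dist: "(hnorm ip (\<lambda>z. U (X p) z - U (X q) z))\<^sup>2 = (hnorm ip (\<lambda>z. X p z - X q z))\<^sup>2" for p q
    proof -
      have "ip (U (X p)) (U (X q)) = ip (X p) (X q)" for p q
        using X(1)[of p] X(1)[of q] by (auto simp: W_def)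
      then show ?thesis using XH by (simp add: hnorm_diff_sq) (simp add: hnorm_sq)
    qed
    obtain h where h: "converges (\<lambda>k. U (X k)) h"
    proof (rule complete_sq[OF XH(2)])
      fix \<epsilon> :: real assume "\<epsilon> > 0"
      then have "\<forall>\<^sub>F k in sequentially. hnorm ip (\<lambda>z. X k z - f z) < sqrt (\<epsilon> / 4)"
        by (intro order_tendstoD(2)[OF convergesD(3)[OF X(2)]]) simp
      then obtain N where N: "\<And>k. k \<ge> N \<Longrightarrow> hnorm ip (\<lambda>z. X k z - f z) < sqrt (\<epsilon> / 4)"
        by (auto simp: eventually_sequentially)
      have "(hnorm ip (\<lambda>z. U (X p) z - U (X q) z))\<^sup>2 < \<epsilon>" if "p \<ge> N" "q \<ge> N" for p q
      proof -
        have D: "(\<lambda>z. X k z - f z) \<in> H" for k using XH f by (simp add: diff_mem)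
        have small: "(hnorm ip (\<lambda>z. X k z - f z))\<^sup>2 < \<epsilon> / 4" if "k \<ge> N" for k
          using power_strict_mono[OF N[OF that] hnorm_nonneg[OF D], of 2] \<open>\<epsilon> > 0\<close> by simp
        have "(hnorm ip (\<lambda>z. X p z - X q z))\<^sup>2
            \<le> 2 * (hnorm ip (\<lambda>z. X p z - f z))\<^sup>2 + 2 * (hnorm ip (\<lambda>z. X q z - f z))\<^sup>2"
          using hnorm_diff_sq_le[OF D D, of p q] by simp
        then show ?thesis unfolding U_dist using small[OF that(1)] small[OF that(2)] by simp
      qed
      then show "\<exists>N. \<forall>p\<ge>N. \<forall>q\<ge>N. (hnorm ip (\<lambda>z. U (X p) z - U (X q) z))\<^sup>2 < \<epsilon>" by blast
    qed (use that in blast)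
    \<comment> \<open>The norm limit of \<open>U (X k)\<close> is identified pointwise with
      \<open>U f\<close>; this is how \<open>U f\<close> is seen to lie in \<open>H\<close>.\<close>
    have "h z = U f z" for z
      using converges_pointwise[OF h, of z] converges_pointwise[OF X(2), of "tmult \<zeta> z"]
      by (auto simp: U_def intro: LIMSEQ_unique)
    then have "h = U f" by blast
    then show "f \<in> S" "\<exists>X. (\<forall>k. X k \<in> W) \<and> converges X f \<and> converges (\<lambda>k. U (X k)) (U f)"
      using X h convergesD(2)[OF h] f by (auto simp: S_def)
  qed
  show "(\<forall>f\<in>H. (\<lambda>z. f (tmult \<zeta> z)) \<in> H) \<and>
     (\<forall>f\<in>H. \<forall>g\<in>H. ip (\<lambda>z. f (tmult \<zeta> z)) (\<lambda>z. g (tmult \<zeta> z)) = ip f g)"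
  proof (intro conjI ballI)
    show "(\<lambda>z. f (tmult \<zeta> z)) \<in> H" if "f \<in> H" for f
      using \<open>\<And>f. f \<in> H \<Longrightarrow> f \<in> S\<close>[OF that] by (simp add: S_def U_def)
    fix f g assume f: "f \<in> H" and g: "g \<in> H"
    obtain X where X: "\<And>k. X k \<in> W" "converges X f" "converges (\<lambda>k. U (X k)) (U f)"
      using W_approx[OF f] by blast
    have gS: "g \<in> S" using g by (rule \<open>\<And>f. f \<in> H \<Longrightarrow> f \<in> S\<close>)
    \<comment> \<open>Only the first argument is approximated: members of \<open>W\<close> may be
      paired with any \<open>g\<close> in \<open>S\<close>, and \<open>S\<close> is by now all of
      \<open>H\<close>.\<close>
    then have "(\<lambda>k. ip (X k) g) \<longlonglongrightarrow> ip (U f) (U g)"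
      using converges_ip[OF X(3), of "U g"] X(1) by (simp add: S_def W_def)
    then have "ip (U f) (U g) = ip f g"
      using converges_ip[OF X(2) g] by (rule LIMSEQ_unique)
    then show "ip (\<lambda>z. f (tmult \<zeta> z)) (\<lambda>z. g (tmult \<zeta> z)) = ip f g" by (simp add: U_def)
  qed
qed

text \<open>Rotating both arguments multiplies the \<open>n\<close>-th term by the squared modulus
  of \<open>zpow \<zeta> n\<close>, which is 1.\<close>

lemma P5_imp_P1:
  assumes P5: "P5 \<Omega> \<kappa> \<Lambda> \<alpha>"
  shows "P1 \<Omega> \<kappa>"
  unfolding P1_def
proof (intro allI impI ballI)
  fix \<zeta> z w :: "complex ^ 'm" assume t: "torus \<zeta>" and zw: "z \<in> \<Omega>" "w \<in> \<Omega>"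
  have series: "((\<lambda>n. complex_of_real (\<alpha> n) * zpow z n * cnj (zpow w n)) has_sum \<kappa> z w) \<Lambda>"
    if "z \<in> \<Omega>" "w \<in> \<Omega>" for z w using P5 that by (auto simp: P5_def)
  have unit: "zpow \<zeta> n * cnj (zpow \<zeta> n) = 1" for n
  proof -
    have "cmod (zpow \<zeta> n) = 1" using t by (simp add: zpow_def torus_def prod_norm[symmetric] norm_power)
    then show ?thesis using cnj_mult_self_eq_1[of "zpow \<zeta> n"] by (simp add: mult.commute)
  qed
  have "complex_of_real (\<alpha> n) * zpow (tmult \<zeta> z) n * cnj (zpow (tmult \<zeta> w) n)
      = (zpow \<zeta> n * cnj (zpow \<zeta> n)) * (complex_of_real (\<alpha> n) * zpow z n * cnj (zpow w n))" for n
    by (simp add: zpow_tmult mult_ac)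
  then have "((\<lambda>n. complex_of_real (\<alpha> n) * zpow z n * cnj (zpow w n)) has_sum
      \<kappa> (tmult \<zeta> z) (tmult \<zeta> w)) \<Lambda>"
    using series[OF tmult_mem[OF t zw(1)] tmult_mem[OF t zw(2)]] by (simp only: unit mult_1_left)
  then show "\<kappa> (tmult \<zeta> z) (tmult \<zeta> w) = \<kappa> z w"
    using series[OF zw] by (rule has_sum_unique)
qed


section \<open>Dyadic averages as projections\<close>

lemma mono_rot: "cmod \<theta> = 1 \<Longrightarrow> mono n (tmult (rot j \<theta>) z) = \<theta> ^ n j * mono n z"
  by (simp add: mono_tmult torus_rot zpow_rot)

text \<open>A Riemann sum for the integral that extracts the part of degree \<open>k\<close> in
  coordinate \<open>j\<close>. It projects onto the functions with
  \<open>f (tmult (rot j \<theta>) z) = \<theta> ^ k * f z\<close> for all \<open>\<theta>\<close>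
  in \<open>dyadic_roots p\<close>.\<close>

definition avg :: "'m \<Rightarrow> nat \<Rightarrow> nat \<Rightarrow> (complex ^ 'm \<Rightarrow> complex) \<Rightarrow> complex ^ 'm \<Rightarrow> complex" where
  "avg j k p f = (\<lambda>z. 1 / 2 ^ p * (\<Sum>\<theta>\<in>dyadic_roots p. cnj \<theta> ^ k * f (tmult (rot j \<theta>) z)))"

text \<open>The sum runs over a group, so shifting its index by \<open>\<eta>\<close> only pulls out
  the factor \<open>\<eta> ^ k\<close>.\<close>

lemma avg_rot:
  assumes \<eta>: "\<eta> \<in> dyadic_roots p"
  shows "avg j k p f (tmult (rot j \<eta>) z) = \<eta> ^ k * avg j k p f z"
proof -
  have n: "cnj \<eta> * \<eta> = 1" by (rule cnj_mult_self_eq_1[OF dyadic_roots_norm[OF \<eta>]])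
  have "(\<Sum>\<theta>\<in>dyadic_roots p. cnj \<theta> ^ k * f (tmult (rot j \<theta>) (tmult (rot j \<eta>) z)))
      = (\<Sum>\<theta>\<in>dyadic_roots p. \<eta> ^ k * (cnj \<theta> ^ k * f (tmult (rot j \<theta>) z)))"
  proof (rule sum.reindex_bij_witness[of _ "\<lambda>\<theta>. \<theta> * cnj \<eta>" "\<lambda>\<theta>. \<theta> * \<eta>"])
    fix \<theta>
    have "\<eta> ^ k * (cnj (\<theta> * \<eta>) ^ k * f (tmult (rot j (\<theta> * \<eta>)) z))
        = (cnj \<eta> * \<eta>) ^ k * (cnj \<theta> ^ k * f (tmult (rot j (\<theta> * \<eta>)) z))"
      by (simp add: power_mult_distrib mult_ac)
    then show "\<eta> ^ k * (cnj (\<theta> * \<eta>) ^ k * f (tmult (rot j (\<theta> * \<eta>)) z))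
        = cnj \<theta> ^ k * f (tmult (rot j \<theta>) (tmult (rot j \<eta>) z))"
      by (simp add: n tmult_rot_rot)
  qed (use \<eta> n in \<open>auto simp: mult.assoc mult.commute[of \<eta> "cnj \<eta>"] intro: dyadic_roots_mult dyadic_roots_cnj\<close>)
  then show ?thesis by (simp add: avg_def sum_distrib_left[symmetric])
qed

context
  assumes P2: "P2 H ip"
begin

lemma rot_mem: "\<lbrakk>cmod \<theta> = 1; f \<in> H\<rbrakk> \<Longrightarrow> (\<lambda>z. f (tmult (rot j \<theta>) z)) \<in> H"
  and ip_rot: "\<lbrakk>cmod \<theta> = 1; f \<in> H; g \<in> H\<rbrakk> \<Longrightarrow>
    ip (\<lambda>z. f (tmult (rot j \<theta>) z)) (\<lambda>z. g (tmult (rot j \<theta>) z)) = ip f g"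
  using P2 torus_rot unfolding P2_def by blast+

lemma ip_rot_left:
  assumes \<theta>: "cmod \<theta> = 1" and f: "f \<in> H" and g: "g \<in> H"
    and hom: "\<And>z. g (tmult (rot j \<theta>) z) = \<theta> ^ k * g z"
  shows "ip (\<lambda>z. f (tmult (rot j \<theta>) z)) g = \<theta> ^ k * ip f g"
proof -
  have "ip f g = ip (\<lambda>z. f (tmult (rot j \<theta>) z)) (\<lambda>z. \<theta> ^ k * g z)"
    using ip_rot[OF \<theta> f g, of j] by (simp add: hom)
  also have "\<dots> = cnj \<theta> ^ k * ip (\<lambda>z. f (tmult (rot j \<theta>) z)) g"
    using \<theta> f g by (simp add: ip_scale_right rot_mem)
  finally have "\<theta> ^ k * ip f g = (cnj \<theta> * \<theta>) ^ k * ip (\<lambda>z. f (tmult (rot j \<theta>) z)) g"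
    by (simp add: power_mult_distrib mult_ac)
  then show ?thesis by (simp add: cnj_mult_self_eq_1 \<theta>)
qed

lemma avg_mem: "f \<in> H \<Longrightarrow> avg j k p f \<in> H"
  unfolding avg_def by (intro scale_mem sum_mem rot_mem) (auto dest: dyadic_roots_norm)

lemma ip_avg_left:
  assumes f: "f \<in> H" and g: "g \<in> H"
  shows "ip (avg j k p f) g = 1 / 2 ^ p *
    (\<Sum>\<theta>\<in>dyadic_roots p. cnj \<theta> ^ k * ip (\<lambda>z. f (tmult (rot j \<theta>) z)) g)"
proof -
  have m: "(\<lambda>z. f (tmult (rot j \<theta>) z)) \<in> H" if "\<theta> \<in> dyadic_roots p" for \<theta>
    using that f by (intro rot_mem dyadic_roots_norm)
  have "ip (avg j k p f) g = 1 / 2 ^ p *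
      ip (\<lambda>z. \<Sum>\<theta>\<in>dyadic_roots p. cnj \<theta> ^ k * f (tmult (rot j \<theta>) z)) g"
    unfolding avg_def by (intro ip_scale_left sum_mem scale_mem m g)
  also have "ip (\<lambda>z. \<Sum>\<theta>\<in>dyadic_roots p. cnj \<theta> ^ k * f (tmult (rot j \<theta>) z)) g
      = (\<Sum>\<theta>\<in>dyadic_roots p. ip (\<lambda>z. cnj \<theta> ^ k * f (tmult (rot j \<theta>) z)) g)"
    by (intro ip_sum_left scale_mem m g)
  also have "\<dots> = (\<Sum>\<theta>\<in>dyadic_roots p. cnj \<theta> ^ k * ip (\<lambda>z. f (tmult (rot j \<theta>) z)) g)"
    by (intro sum.cong refl ip_scale_left m g)
  finally show ?thesis .
qed

text \<open>\<open>avg j k q f\<close> is homogeneous under \<open>dyadic_roots q\<close>, hence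
  under the smaller group \<open>dyadic_roots p\<close>; so each of the \<open>2 ^ p\<close>
  summands equals \<open>ip f (avg j k q f)\<close>.\<close>

lemma ip_avg_avg:
  assumes f: "f \<in> H" and pq: "p \<le> q"
  shows "ip (avg j k p f) (avg j k q f) = ip f (avg j k q f)"
proof -
  have "ip (avg j k p f) (avg j k q f)
      = 1 / 2 ^ p * (\<Sum>\<theta>\<in>dyadic_roots p. ip f (avg j k q f))"
    unfolding ip_avg_left[OF f avg_mem[OF f]]
  proof (intro arg_cong[where f = "(*) _"] sum.cong refl)
    fix \<theta> assume \<theta>: "\<theta> \<in> dyadic_roots p"
    then have q: "\<theta> \<in> dyadic_roots q" using dyadic_roots_mono[OF pq] by blast
    have n: "cmod \<theta> = 1" using \<theta> by (rule dyadic_roots_norm)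
    have "cnj \<theta> ^ k * ip (\<lambda>z. f (tmult (rot j \<theta>) z)) (avg j k q f)
        = (cnj \<theta> * \<theta>) ^ k * ip f (avg j k q f)"
      by (simp add: ip_rot_left[OF n f avg_mem[OF f] avg_rot[OF q]] power_mult_distrib)
    then show "cnj \<theta> ^ k * ip (\<lambda>z. f (tmult (rot j \<theta>) z)) (avg j k q f) = ip f (avg j k q f)"
      by (simp add: cnj_mult_self_eq_1[OF n])
  qed
  then show ?thesis by (simp add: card_dyadic_roots)
qed

text \<open>By \<open>ip_avg_avg\<close>, the product of two averages is the squared norm
  \<open>b q\<close> of the finer one, so their squared distance is \<open>b p - b q\<close>, with
  \<open>b\<close> decreasing and nonnegative.\<close>

lemma avg_converges:
  assumes f: "f \<in> H"
  obtains g where "converges (\<lambda>p. avg j k p f) g"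
proof -
  define b where "b p = (hnorm ip (avg j k p f))\<^sup>2" for p
  have ipb: "ip (avg j k p f) (avg j k q f) = complex_of_real (b q)" if "p \<le> q" for p q
    using ip_avg_avg[OF f that, of j k] ip_avg_avg[OF f order_refl, of j k q]
    by (simp add: b_def ip_self avg_mem f)
  have diff: "(hnorm ip (\<lambda>z. avg j k p f z - avg j k q f z))\<^sup>2 = b p - b q" if "p \<le> q" for p q
    using ipb[OF that] by (simp add: hnorm_diff_sq avg_mem f b_def)
  have "decseq b"
    unfolding decseq_def using diff by (metis diff_ge_0_iff_ge zero_le_power2)
  then have "Cauchy b"
    using decseq_convergent[of b 0] by (metis LIMSEQ_imp_Cauchy b_def zero_le_power2)
  then show ?thesis
    using complete_Cauchy[of "\<lambda>p. avg j k p f" b] diff avg_mem[OF f] that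
    by (metis abs_ge_self)
qed

text \<open>Rotating the left monomial multiplies the inner product by
  \<open>\<theta> ^ n j\<close>; moving the rotation to the right one gives
  \<open>\<theta> ^ k j\<close>. A dyadic root separating these powers exists because only finitely
  many numbers satisfy \<open>\<theta> ^ d = 1\<close>, where \<open>d\<close> is the distance of
  the two exponents.\<close>

lemma mono_orth:
  assumes n: "mono n \<in> H" and k: "mono k \<in> H" and nk: "n \<noteq> k"
  shows "ip (mono n) (mono k) = 0"
proof -
  obtain j where j: "n j \<noteq> k j" using nk by auto
  have "\<exists>p. \<exists>\<theta>\<in>dyadic_roots p. \<theta> ^ n j \<noteq> \<theta> ^ k j"
  proof (rule ccontr)
    define d where "d = max (n j) (k j) - min (n j) (k j)"
    assume "\<not> ?thesis"
    then have eq: "\<theta> ^ n j = \<theta> ^ k j" if "\<theta> \<in> dyadic_roots p" for \<theta> p using that by blast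
    have "\<theta> ^ d = 1" if "\<theta> \<in> dyadic_roots p" for \<theta> p
    proof -
      have "\<theta> \<noteq> 0" using dyadic_roots_norm[OF that] by auto
      then show ?thesis
        using eq[OF that] j by (cases "n j < k j") (auto simp: d_def power_diff)
    qed
    then have "(\<Union>p. dyadic_roots p) \<subseteq> {\<theta>. \<theta> ^ d = 1}" by blast
    moreover have "d \<ge> 1" using j by (auto simp: d_def)
    ultimately show False using infinite_dyadic_roots finite_roots_unity finite_subset by metis
  qed
  then obtain \<theta> where \<theta>: "cmod \<theta> = 1" "\<theta> ^ n j \<noteq> \<theta> ^ k j" using dyadic_roots_norm by blast
  have "\<theta> ^ n j * ip (mono n) (mono k) = ip (\<lambda>z. mono n (tmult (rot j \<theta>) z)) (mono k)"
    using \<theta>(1) n k by (simp add: mono_rot ip_scale_left)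
  also have "\<dots> = \<theta> ^ k j * ip (mono n) (mono k)"
    using \<theta>(1) n k by (intro ip_rot_left mono_rot)
  finally show ?thesis using \<theta>(2) by simp
qed

text \<open>Averaging in a new coordinate must keep what is already achieved. Orthogonality survives
  because a rotation of \<open>f\<close> multiplies \<open>ip f (mono m)\<close> by a scalar, the
  old homogeneities because rotations commute, and nonvanishing because the averages are bounded
  below at one fixed point.\<close>

lemma homogeneous_orth_component:
  assumes f: "f \<in> H" "f \<noteq> (\<lambda>z. 0)" and orth: "\<And>n. mono n \<in> H \<Longrightarrow> ip f (mono n) = 0" and S: "finite S"
  shows "\<exists>g n. g \<in> H \<and> g \<noteq> (\<lambda>z. 0) \<and> (\<forall>m. mono m \<in> H \<longrightarrow> ip g (mono m) = 0) \<and>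
    (\<forall>i\<in>S. \<forall>q. \<forall>\<theta>\<in>dyadic_roots q. \<forall>z. g (tmult (rot i \<theta>) z) = \<theta> ^ n i * g z)"
  using S
proof induction
  case empty
  then show ?case using f orth by auto
next
  case (insert j S)
  then obtain f n where f: "f \<in> H" "f \<noteq> (\<lambda>z. 0)" and orth: "\<And>m. mono m \<in> H \<Longrightarrow> ip f (mono m) = 0"
    and hom: "\<And>i q \<theta> z. \<lbrakk>i \<in> S; \<theta> \<in> dyadic_roots q\<rbrakk> \<Longrightarrow> f (tmult (rot i \<theta>) z) = \<theta> ^ n i * f z"
    by blast
  \<comment> \<open>By the identity theorem a nonzero function of \<open>H\<close> is nonzero
    somewhere in the polydisc, so some slice in direction \<open>j\<close> is not identically zero;
    that slice determines \<open>k\<close>.\<close>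
  have "\<exists>z\<in>polydisc rad. f z \<noteq> 0"
    using eq_if_eq_near_0[OF f(1) holo_on_const[of \<Omega> 0] _ rad(1)] f(2) by blast
  then obtain z where z: "z \<in> polydisc rad" "f z \<noteq> 0" by blast
  have "upd z j (z $ j) = z" by (simp add: upd_def vec_eq_iff)
  then have slice: "z $ j \<in> ball 0 rad" "f (upd z j (z $ j)) \<noteq> 0"
    using z by (simp_all add: polydisc_def)
  obtain k x \<delta> where \<delta>: "\<delta> > 0"
    "\<And>p. \<delta> \<le> cmod ((\<Sum>\<theta>\<in>dyadic_roots p. cnj \<theta> ^ k * f (upd z j (\<theta> * x))) / 2 ^ p)"
    by (rule dyadic_averages_bounded_below[OF holo_on_slice[OF holo_on_subset[OF holo[OF f(1)] rad(2)] z(1)] slice])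
       (rule that)
  obtain g where g: "converges (\<lambda>p. avg j k p f) g" using avg_converges[OF f(1)] by blast
  note lim = converges_pointwise[OF g]
  have "(\<lambda>p. cmod (avg j k p f (upd z j x))) \<longlonglongrightarrow> cmod (g (upd z j x))"
    by (intro tendsto_norm lim)
  moreover have "\<delta> \<le> cmod (avg j k p f (upd z j x))" for p
    using \<delta>(2)[of p] by (simp add: avg_def tmult_rot_upd)
  \<comment> \<open>\<open>\<delta>\<close> does not depend on \<open>p\<close>, so the bound passes
    to the limit.\<close>
  ultimately have "\<delta> \<le> cmod (g (upd z j x))" by (intro LIMSEQ_le_const) auto
  then have g0: "g \<noteq> (\<lambda>z. 0)" using \<delta>(1) by auto
  have gorth: "ip g (mono m) = 0" if m: "mono m \<in> H" for m
  proof -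
    have "ip (avg j k p f) (mono m) = 0" for p
      unfolding ip_avg_left[OF f(1) m]
      by (auto intro!: sum.neutral simp: ip_rot_left[OF _ f(1) m mono_rot] dyadic_roots_norm orth m)
    then show ?thesis using converges_ip[OF g m] by (simp add: LIMSEQ_const_iff)
  qed
  have "g (tmult (rot i \<theta>) w) = \<theta> ^ (n(j := k)) i * g w" if i: "i \<in> insert j S" and \<theta>: "\<theta> \<in> dyadic_roots q" for i q \<theta> w
  proof (cases "i = j")
    case True
    \<comment> \<open>For \<open>p \<ge> q\<close> the root \<open>\<theta>\<close> is among those
      averaged over, so the relation holds eventually.\<close>
    have "\<forall>\<^sub>F p in sequentially. avg j k p f (tmult (rot j \<theta>) w) = \<theta> ^ k * avg j k p f w"
      using eventually_ge_at_top[of q]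
      by eventually_elim (use \<theta> dyadic_roots_mono in \<open>blast intro: avg_rot\<close>)
    then have "(\<lambda>p. \<theta> ^ k * avg j k p f w) \<longlonglongrightarrow> g (tmult (rot j \<theta>) w)"
      using lim[of "tmult (rot j \<theta>) w"] by (rule Lim_transform_eventually[rotated])
    moreover have "(\<lambda>p. \<theta> ^ k * avg j k p f w) \<longlonglongrightarrow> \<theta> ^ k * g w" by (intro tendsto_intros lim)
    ultimately show ?thesis using True LIMSEQ_unique by auto
  next
    case False
    then have "i \<in> S" using i by simp
    have "avg j k p f (tmult (rot i \<theta>) w) = \<theta> ^ n i * avg j k p f w" for p
      unfolding avg_def tmult_rot_comm[of j _ i \<theta>] hom[OF \<open>i \<in> S\<close> \<theta>]
      by (simp add: sum_distrib_left mult_ac)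
    then have "(\<lambda>p. \<theta> ^ n i * avg j k p f w) \<longlonglongrightarrow> g (tmult (rot i \<theta>) w)"
      using lim[of "tmult (rot i \<theta>) w"] by simp
    moreover have "(\<lambda>p. \<theta> ^ n i * avg j k p f w) \<longlonglongrightarrow> \<theta> ^ n i * g w" by (intro tendsto_intros lim)
    ultimately show ?thesis using False LIMSEQ_unique by auto
  qed
  then show ?case using convergesD(2)[OF g] g0 gorth by blast
qed

lemma mono_total:
  assumes f: "f \<in> H" and orth: "\<And>n. mono n \<in> H \<Longrightarrow> ip f (mono n) = 0"
  shows "f = (\<lambda>z. 0)"
proof (rule ccontr)
  assume "f \<noteq> (\<lambda>z. 0)"
  from homogeneous_orth_component[OF f this orth finite, of UNIV]
  obtain g n where g: "g \<in> H" "g \<noteq> (\<lambda>z. 0)" "\<And>m. mono m \<in> H \<Longrightarrow> ip g (mono m) = 0"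
    and hom: "\<And>i q \<theta> z. \<theta> \<in> dyadic_roots q \<Longrightarrow> g (tmult (rot i \<theta>) z) = \<theta> ^ n i * g z"
    by blast
  obtain c where "\<And>z. z \<in> \<Omega> \<Longrightarrow> g z = c * zpow z n"
  proof (rule homogeneous_imp_monomial[OF holo[OF g(1)] domain zero_in_domain])
    show "g (tmult (rot j \<theta>) z) = \<theta> ^ n j * g z" if "\<theta> \<in> dyadic_roots q" for j z q \<theta>
      using that by (rule hom)
  qed (use that in blast)
  then have gc: "g = (\<lambda>z. c * mono n z)"
    using vanish_outside[OF g(1)] by (auto simp: mono_fn_def)
  \<comment> \<open>As \<open>c\<close> is nonzero, \<open>mono n\<close> itself lies in
    \<open>H\<close>; being a multiple of \<open>g\<close>, it is orthogonal to itself.\<close>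
  then have "c \<noteq> 0" using g(2) by auto
  then have mono: "mono n = (\<lambda>z. (1 / c) * g z)" by (simp add: gc)
  then have mem: "mono n \<in> H" using scale_mem[OF g(1), of "1 / c"] by simp
  have "ip (mono n) (mono n) = 0"
    using g(1) g(3)[OF mem] mem ip_scale_left[OF g(1) mem, of "1 / c"] mono by simp
  then show False using ip_definite[OF mem] mono_nonzero by blast
qed

lemma P2_imp_P4: "P4 \<Omega> H ip {n. mono n \<in> H}"
  unfolding P4_def
proof (intro conjI ballI impI inductive_mono)
  show "f = (\<lambda>z. 0)" if "f \<in> H" "\<forall>n\<in>{n. mono n \<in> H}. ip f (mono n) = 0" for f
    using that mono_total by blast
qed (auto simp: mono_nonzero mono_orth)

text \<open>A monomial of \<open>H\<close> with index outside \<open>\<Lambda>\<close> is orthogonal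
  to the whole basis by \<open>mono_orth\<close>, hence zero, which no monomial is.\<close>

lemma P4_index:
  assumes P4: "P4 \<Omega> H ip \<Lambda>"
  shows "\<Lambda> = {n. mono n \<in> H}"
proof (intro equalityI subsetI)
  fix n assume "n \<in> {n. mono n \<in> H}"
  then have n: "mono n \<in> H" by simp
  show "n \<in> \<Lambda>"
  proof (rule ccontr)
    assume "n \<notin> \<Lambda>"
    then have "ip (mono n) (mono k) = 0" if "k \<in> \<Lambda>" for k
      using that P4 n by (intro mono_orth) (auto simp: P4_def)
    then show False using P4 n mono_nonzero by (auto simp: P4_def)
  qed
qed (use P4 in \<open>auto simp: P4_def\<close>)

end

section \<open>Monomial bases and series representations\<close>

lemma taylor0_mono: "taylor0 (mono k) (\<lambda>n. if n = k then 1 else 0)"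
proof (rule taylor0I[OF rad(1)])
  fix z :: "complex ^ 'm" assume "z \<in> polydisc rad"
  then have "mono k z = zpow z k" using rad(2) by (auto simp: mono_fn_def)
  moreover have "((\<lambda>n. (if n = k then 1 else 0) * zpow z n) has_sum zpow z k) {k}"
    by (simp add: has_sum_finite_iff)
  ultimately show "((\<lambda>n. (if n = k then 1 else 0) * zpow z n) has_sum mono k z) UNIV"
    by (subst has_sum_cong_neutral[where T = "{k}" and g = "\<lambda>n. (if n = k then 1 else 0) * zpow z n"]) auto
qed

text \<open>\<open>eq_H2\<close> supplies functions only through their Taylor series at 0; this
  recognises the one with a single coefficient.\<close>

lemma eq_mono_if_taylor0:
  assumes f: "f \<in> H" and t: "taylor0 f (\<lambda>n. if n = k then 1 else 0)"
  shows "f = mono k"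
proof -
  obtain r where r: "r > 0"
    "\<And>z. z \<in> polydisc r \<Longrightarrow> ((\<lambda>n. (if n = k then 1 else 0) * zpow z n) has_sum f z) UNIV"
    using t by (rule taylor0E) (rule that)
  obtain s where s: "s > 0"
    "\<And>z. z \<in> polydisc s \<Longrightarrow> ((\<lambda>n. (if n = k then 1 else 0) * zpow z n) has_sum mono k z) UNIV"
    using taylor0_mono by (rule taylor0E) (rule that)
  show ?thesis
  proof (rule eq_if_eq_near_0[OF f holo_mono])
    show "min r s > 0" using r s by simp
    fix z :: "complex ^ 'm" assume "z \<in> polydisc (min r s)"
    then have "z \<in> polydisc r" "z \<in> polydisc s" by (auto simp: polydisc_def)
    then show "f z = mono k z" using r(2) s(2) has_sum_unique by blast
  qed (simp add: mono_fn_def)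
qed

context
  fixes \<Lambda>
  assumes P4: "P4 \<Omega> H ip \<Lambda>"
begin

lemma orthogonal_system_mono:
  "orthogonal_system \<Omega> H ip mono \<Lambda> (\<lambda>p. {n \<in> \<Lambda>. \<forall>i. n i \<le> p})"
proof unfold_locales
  fix n k p
  show "n \<in> \<Lambda> \<Longrightarrow> mono n \<in> H" "n \<in> \<Lambda> \<Longrightarrow> mono n \<noteq> (\<lambda>z. 0)"
    "\<lbrakk>n \<in> \<Lambda>; k \<in> \<Lambda>; n \<noteq> k\<rbrakk> \<Longrightarrow> ip (mono n) (mono k) = 0"
    using P4 by (auto simp: P4_def)
  show "finite {n \<in> \<Lambda>. \<forall>i. n i \<le> p}"
    by (rule finite_subset[OF _ finite_bounded_multiindices[of p]]) auto
  show "incseq (\<lambda>p. {n \<in> \<Lambda>. \<forall>i. n i \<le> p})" unfolding incseq_def using order_trans by blast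
  have "n \<in> (\<Union>p. {n \<in> \<Lambda>. \<forall>i. n i \<le> p})" if "n \<in> \<Lambda>" for n
    \<comment> \<open>Each exponent is at most the total degree, which therefore bounds the stage at
      which \<open>n\<close> appears.\<close>
    using that by (intro UN_I[of "sum n UNIV"]) (auto simp: member_le_sum)
  then show "(\<Union>p. {n \<in> \<Lambda>. \<forall>i. n i \<le> p}) = \<Lambda>" by auto
qed

interpretation os: orthogonal_system \<Omega> H ip mono \<Lambda> "\<lambda>p. {n \<in> \<Lambda>. \<forall>i. n i \<le> p}"
  by (rule orthogonal_system_mono)

lemma P4_total: "\<lbrakk>f \<in> H; \<And>n. n \<in> \<Lambda> \<Longrightarrow> ip f (mono n) = 0\<rbrakk> \<Longrightarrow> f = (\<lambda>z. 0)"
  using P4 by (auto simp: P4_def)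

text \<open>Parseval against the kernel function at \<open>z\<close>; this yields convergence on all
  of \<open>\<Omega>\<close>, not just near 0.\<close>

lemma pointwise_expansion:
  assumes f: "f \<in> H" and z: "z \<in> \<Omega>"
  shows "((\<lambda>n. os.coef f n * zpow z n) has_sum f z) \<Lambda>"
proof -
  have "((\<lambda>n. os.coef f n * ip (mono n) (ker z)) has_sum f z) \<Lambda>"
    using os.Parseval[OF P4_total f ker_mem[OF z]] f z by (simp add: reproducing)
  also have "?this \<longleftrightarrow> ?thesis"
  proof (rule has_sum_cong)
    show "os.coef f n * ip (mono n) (ker z) = os.coef f n * zpow z n" if "n \<in> \<Lambda>" for n
      using reproducing[OF z os.e_mem[OF that]] z by (simp add: mono_fn_def)
  qed
  finally show ?thesis .
qed

text \<open>By the reproducing property the kernel function at \<open>w\<close> has coefficients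
  \<open>cnj (zpow w n) / os.weight n\<close>, so its pointwise expansion is the required
  series.\<close>

lemma P4_imp_P5: "P5 \<Omega> \<kappa> \<Lambda> (\<lambda>n. 1 / os.weight n)"
  unfolding P5_def
proof (intro conjI ballI)
  fix z w assume z: "z \<in> \<Omega>" and w: "w \<in> \<Omega>"
  have "os.coef (ker w) n = complex_of_real (1 / os.weight n) * cnj (zpow w n)" if "n \<in> \<Lambda>" for n
    using ip_cnj[OF os.e_mem[OF that] ker_mem[OF w]] os.e_mem[OF that] w
    by (simp add: os.coef_def reproducing mono_fn_def)
  then have "((\<lambda>n. complex_of_real (1 / os.weight n) * zpow z n * cnj (zpow w n)) has_sum ker w z) \<Lambda>"
    by (intro has_sum_cong[THEN iffD1, OF _ pointwise_expansion[OF ker_mem[OF w] z]]) simp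
  then show "((\<lambda>n. complex_of_real (1 / os.weight n) * zpow z n * cnj (zpow w n)) has_sum \<kappa> z w) \<Lambda>"
    using z by (simp add: ker_def)
qed (use P4 in \<open>auto simp: P4_def os.weight_pos\<close>)

text \<open>\<open>P3\<close> asks for a positive \<open>\<beta> n\<close> at every
  \<open>n\<close>, so 1 fills the indices outside \<open>\<Lambda>\<close>, where the coefficients
  are 0.\<close>

lemma P4_imp_P3: "P3 H ip (\<lambda>n. if n \<in> \<Lambda> then hnorm ip (mono n) else 1) \<Lambda>"
proof -
  define \<beta> where "\<beta> n = (if n \<in> \<Lambda> then hnorm ip (mono n) else 1)" for n
  have \<beta>: "(\<beta> n)\<^sup>2 = os.weight n" if "n \<in> \<Lambda>" for n using that by (simp add: \<beta>_def os.weight_def)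
  \<comment> \<open>Outside \<open>\<Lambda>\<close> the quotient \<open>os.coef f n\<close> carries
    no information about \<open>f\<close>, so it is cut off to become the Taylor
    coefficient.\<close>
  define t where "t f n = (if n \<in> \<Lambda> then os.coef f n else 0)" for f n
  have taylor: "taylor0 f (t f)" if f: "f \<in> H" for f
  proof (rule taylor0I[OF rad(1)])
    fix z :: "complex ^ 'm" assume "z \<in> polydisc rad"
    then have "z \<in> \<Omega>" using rad(2) by blast
    from pointwise_expansion[OF f this] show "((\<lambda>n. t f n * zpow z n) has_sum f z) UNIV"
      by (rule has_sum_cong_neutral[THEN iffD1, rotated -1]) (auto simp: t_def)
  qed
  have "eq_H2 H ip \<beta> \<Lambda>"
    unfolding eq_H2_def
  proof (intro conjI ballI allI impI)
    fix f assume f: "f \<in> H"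
    have "((\<lambda>n. os.coef f n * ip (mono n) f) has_sum ip f f) \<Lambda>"
      by (rule os.Parseval[OF P4_total f f])
    also have "?this \<longleftrightarrow> ((\<lambda>n. complex_of_real ((cmod (t f n))\<^sup>2 * (\<beta> n)\<^sup>2)) has_sum complex_of_real ((hnorm ip f)\<^sup>2)) \<Lambda>"
      unfolding ip_self[OF f]
    proof (rule has_sum_cong)
      fix n assume n: "n \<in> \<Lambda>"
      have "os.coef f n * ip (mono n) f = (os.coef f n * cnj (os.coef f n)) * complex_of_real (os.weight n)"
        using ip_cnj[OF f os.e_mem[OF n]] n by (simp add: os.ip_eq_coef)
      then show "os.coef f n * ip (mono n) f = complex_of_real ((cmod (t f n))\<^sup>2 * (\<beta> n)\<^sup>2)"
        by (simp only: t_def n \<beta> if_True complex_norm_square[symmetric] of_real_mult)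
    qed
    also have "\<dots> \<longleftrightarrow> ((\<lambda>n. (cmod (t f n))\<^sup>2 * (\<beta> n)\<^sup>2) has_sum (hnorm ip f)\<^sup>2) \<Lambda>"
      by (rule has_sum_of_real_iff)
    also have "\<dots> \<longleftrightarrow> ((\<lambda>n. (cmod (t f n))\<^sup>2 * (\<beta> n)\<^sup>2) has_sum (hnorm ip f)\<^sup>2) UNIV"
      by (rule has_sum_cong_neutral) (auto simp: t_def)
    finally show "\<exists>a. taylor0 f a \<and> (\<forall>n. n \<notin> \<Lambda> \<longrightarrow> a n = 0) \<and>
         ((\<lambda>n. (cmod (a n))\<^sup>2 * (\<beta> n)\<^sup>2) has_sum (hnorm ip f)\<^sup>2) UNIV"
      using taylor[OF f] by (intro exI[of _ "t f"]) (simp add: t_def)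
  next
    fix a assume a: "(\<forall>n. n \<notin> \<Lambda> \<longrightarrow> a n = 0) \<and> (\<lambda>n. (cmod (a n))\<^sup>2 * (\<beta> n)\<^sup>2) summable_on UNIV"
    \<comment> \<open>Square summability bounds the finite sums as \<open>Riesz_Fischer\<close>
      requires; the resulting limit has Taylor coefficients \<open>a\<close>.\<close>
    have bound: "(\<Sum>n\<in>A. (cmod (a n))\<^sup>2 * os.weight n) \<le> (\<Sum>\<^sub>\<infinity>n. (cmod (a n))\<^sup>2 * (\<beta> n)\<^sup>2)"
      if A: "finite A" "A \<subseteq> \<Lambda>" for A
    proof -
      have "(\<Sum>n\<in>A. (cmod (a n))\<^sup>2 * os.weight n) = (\<Sum>n\<in>A. (cmod (a n))\<^sup>2 * (\<beta> n)\<^sup>2)"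
        using A \<beta> by (intro sum.cong) auto
      also have "\<dots> \<le> (\<Sum>\<^sub>\<infinity>n. (cmod (a n))\<^sup>2 * (\<beta> n)\<^sup>2)"
        using a A by (intro finite_sum_le_infsum) auto
      finally show ?thesis .
    qed
    obtain h where h: "converges (\<lambda>p. os.psum {n \<in> \<Lambda>. \<forall>i. n i \<le> p} a) h"
      "\<And>n. n \<in> \<Lambda> \<Longrightarrow> os.coef h n = a n"
      by (rule os.Riesz_Fischer[OF bound]; (assumption | rule that))
    have "t h = a" using h(2) a by (auto simp: t_def)
    then show "\<exists>f\<in>H. taylor0 f a" using taylor convergesD(2)[OF h(1)] by metis
  qed
  moreover have "\<beta> n > 0" for n
    using hnorm_pos[OF os.e_mem mono_nonzero, of n] by (simp add: \<beta>_def)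
  ultimately show ?thesis using P4 by (simp add: P3_def P4_def \<beta>_def[abs_def])
qed

end

text \<open>\<open>eq_H2\<close> prescribes norms and Taylor coefficients but no inner products. The
  product of \<open>f\<close> with a monomial is recovered from norms and is a multiple of the
  Taylor coefficient, so orthogonality and totality become statements about coefficients.\<close>

lemma P3_imp_P4:
  assumes P3: "P3 H ip \<beta> \<Lambda>"
  shows "P4 \<Omega> H ip \<Lambda>"
proof -
  have eq1: "\<exists>a. taylor0 f a \<and> (\<forall>n. n \<notin> \<Lambda> \<longrightarrow> a n = 0) \<and>
         ((\<lambda>n. (cmod (a n))\<^sup>2 * (\<beta> n)\<^sup>2) has_sum (hnorm ip f)\<^sup>2) UNIV" if "f \<in> H" for f
    using P3 that by (auto simp: P3_def eq_H2_def)
  have eq2: "\<exists>f\<in>H. taylor0 f a" if "\<forall>n. n \<notin> \<Lambda> \<longrightarrow> a n = 0"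
    "(\<lambda>n. (cmod (a n))\<^sup>2 * (\<beta> n)\<^sup>2) summable_on UNIV" for a
    using P3 that by (auto simp: P3_def eq_H2_def)
  \<comment> \<open>Uniqueness of Taylor coefficients makes the norm formula available for any known
    expansion of \<open>f\<close>, not just the one that \<open>eq_H2\<close> provides.\<close>
  have norm: "((\<lambda>n. (cmod (a n))\<^sup>2 * (\<beta> n)\<^sup>2) has_sum (hnorm ip f)\<^sup>2) UNIV"
    if "f \<in> H" "taylor0 f a" for f a
    using eq1[OF that(1)] taylor0_unique[OF that(2)] by metis
  have mono: "mono k \<in> H" if "k \<in> \<Lambda>" for k
  proof -
    define a :: "('m \<Rightarrow> nat) \<Rightarrow> complex" where "a n = (if n = k then 1 else 0)" for n
    have supp: "\<forall>n. n \<notin> \<Lambda> \<longrightarrow> a n = 0" using that by (auto simp: a_def)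
    have "(\<lambda>n. (cmod (a n))\<^sup>2 * (\<beta> n)\<^sup>2) summable_on {k}" by simp
    also have "?this \<longleftrightarrow> (\<lambda>n. (cmod (a n))\<^sup>2 * (\<beta> n)\<^sup>2) summable_on UNIV"
      by (rule summable_on_cong_neutral) (auto simp: a_def)
    finally obtain f where "f \<in> H" "taylor0 f a" using eq2[OF supp] by blast
    then show ?thesis using eq_mono_if_taylor0[of f k] by (simp add: a_def[abs_def])
  qed
  have norm_mono: "(hnorm ip (mono k))\<^sup>2 = (\<beta> k)\<^sup>2" if "k \<in> \<Lambda>" for k
  proof -
    have "((\<lambda>n. (cmod (if n = k then 1 else 0))\<^sup>2 * (\<beta> n)\<^sup>2) has_sum (\<beta> k)\<^sup>2) {k}"
      by (simp add: has_sum_finite_iff)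
    also have "?this \<longleftrightarrow> ((\<lambda>n. (cmod (if n = k then 1 else 0))\<^sup>2 * (\<beta> n)\<^sup>2) has_sum (\<beta> k)\<^sup>2) UNIV"
      by (rule has_sum_cong_neutral) auto
    finally show ?thesis using norm[OF mono[OF that] taylor0_mono] by (rule has_sum_unique[rotated])
  qed
  \<comment> \<open>Comparing the norms of \<open>f\<close> and \<open>f + c z\<^sup>k\<close> for \<open>c = 1\<close> and \<open>c = \<i>\<close> gives the inner product.\<close>
  have ip_mono: "ip f (mono k) = a k * complex_of_real ((\<beta> k)\<^sup>2)"
    if f: "f \<in> H" and a: "taylor0 f a" and k: "k \<in> \<Lambda>" for f a k
  proof -
    have "Re (cnj c * ip f (mono k)) = Re (cnj c * a k) * (\<beta> k)\<^sup>2" for c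
    proof -
      define b where "b n = a n + c * (if n = k then 1 else 0)" for n
      have mem: "(\<lambda>z. f z + c * mono k z) \<in> H" using f mono[OF k] by (intro add_mem scale_mem)
      have "((\<lambda>n. (cmod (b n))\<^sup>2 * (\<beta> n)\<^sup>2) has_sum (hnorm ip (\<lambda>z. f z + c * mono k z))\<^sup>2) UNIV"
        using norm[OF mem taylor0_add_scale[OF a taylor0_mono]] by (simp add: b_def)
      from has_sum_add[OF this has_sum_cmult_right[OF norm[OF f a], of "-1"]]
      have "((\<lambda>n. (cmod (b n))\<^sup>2 * (\<beta> n)\<^sup>2 - (cmod (a n))\<^sup>2 * (\<beta> n)\<^sup>2) has_sum
          (hnorm ip (\<lambda>z. f z + c * mono k z))\<^sup>2 - (hnorm ip f)\<^sup>2) UNIV" by simp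
      \<comment> \<open>The two coefficient families differ only at \<open>k\<close>, so the
        difference of the norm series is a single term.\<close>
      also have "?this \<longleftrightarrow> ((\<lambda>n. (cmod (b n))\<^sup>2 * (\<beta> n)\<^sup>2 - (cmod (a n))\<^sup>2 * (\<beta> n)\<^sup>2) has_sum
          (hnorm ip (\<lambda>z. f z + c * mono k z))\<^sup>2 - (hnorm ip f)\<^sup>2) {k}"
        by (rule has_sum_cong_neutral) (auto simp: b_def)
      finally have "(hnorm ip (\<lambda>z. f z + c * mono k z))\<^sup>2 - (hnorm ip f)\<^sup>2
          = ((cmod (a k + c))\<^sup>2 - (cmod (a k))\<^sup>2) * (\<beta> k)\<^sup>2"
        by (simp add: has_sum_finite_iff b_def left_diff_distrib)
      moreover have "(hnorm ip (\<lambda>z. f z + c * mono k z))\<^sup>2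
          = (hnorm ip f)\<^sup>2 + (cmod c)\<^sup>2 * (\<beta> k)\<^sup>2 + 2 * Re (cnj c * ip f (mono k))"
        using hnorm_diff_sq[OF f scale_mem[OF mono[OF k]], of "-c"]
          hnorm_scale_sq[OF mono[OF k], of "-c"] ip_scale_right[OF mono[OF k] f, of "-c"]
        by (simp add: norm_mono k)
      moreover have "(cmod (a k + c))\<^sup>2 = (cmod (a k))\<^sup>2 + (cmod c)\<^sup>2 + 2 * Re (cnj c * a k)"
        unfolding cmod_power2 by (simp add: power2_eq_square algebra_simps)
      ultimately show ?thesis by (simp add: algebra_simps)
    qed
    from this[of 1] this[of \<i>] show ?thesis by (simp add: complex_eq_iff)
  qed
  have \<beta>: "\<beta> n > 0" for n using P3 by (simp add: P3_def)
  show ?thesis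
    unfolding P4_def
  proof (intro conjI ballI impI)
    show "inductive_mset \<Lambda>" using P3 by (simp add: P3_def)
    show "ip (mono n) (mono k) = 0" if "n \<in> \<Lambda>" "k \<in> \<Lambda>" "n \<noteq> k" for n k
      using ip_mono[OF mono[OF that(1)] taylor0_mono that(2)] that(3) by simp
    fix f assume f: "f \<in> H" and orth: "\<forall>n\<in>\<Lambda>. ip f (mono n) = 0"
    obtain a where a: "taylor0 f a" "\<forall>n. n \<notin> \<Lambda> \<longrightarrow> a n = 0"
      "((\<lambda>n. (cmod (a n))\<^sup>2 * (\<beta> n)\<^sup>2) has_sum (hnorm ip f)\<^sup>2) UNIV"
      using eq1[OF f] by blast
    have "a n = 0" for n
    proof (cases "n \<in> \<Lambda>")
      case True
      then show ?thesis using ip_mono[OF f a(1) True] orth \<beta>[of n] by simp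
    qed (use a in simp)
    then have "(hnorm ip f)\<^sup>2 = 0" using a(3) has_sum_0 has_sum_unique by fastforce
    then show "f = (\<lambda>z. 0)" using hnorm_pos[OF f] by fastforce
  qed (use mono mono_nonzero in auto)
qed

text \<open>At a point \<open>w\<close> without zero coordinates, the Taylor coefficients of
  \<open>ker w\<close> are nonzero exactly on the index set, and these coefficients are
  unique.\<close>

lemma P5_index:
  assumes "P5 \<Omega> \<kappa> \<Lambda> \<alpha>" and "P5 \<Omega> \<kappa> \<Lambda>' \<alpha>'"
  shows "\<Lambda> = \<Lambda>'"
proof -
  define w :: "complex ^ 'm" where "w = (\<chi> i. complex_of_real (rad / 2))"
  have w: "w \<in> \<Omega>" using rad diag_mem_polydisc[OF rad(1)] by (auto simp: w_def)
  have zpow_w: "zpow w n \<noteq> 0" for n using rad(1) by (intro zpow_nonzero) (simp add: w_def)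
  have taylor: "taylor0 (ker w) (\<lambda>n. if n \<in> L then complex_of_real (A n) * cnj (zpow w n) else 0)"
    if P5: "P5 \<Omega> \<kappa> L A" for L A
  proof (rule taylor0I[OF rad(1)])
    fix z :: "complex ^ 'm" assume "z \<in> polydisc rad"
    then have z: "z \<in> \<Omega>" using rad(2) by blast
    then have "((\<lambda>n. complex_of_real (A n) * zpow z n * cnj (zpow w n)) has_sum ker w z) L"
      using P5 w by (simp add: P5_def ker_def)
    then show "((\<lambda>n. (if n \<in> L then complex_of_real (A n) * cnj (zpow w n) else 0) * zpow z n)
        has_sum ker w z) UNIV"
      by (rule has_sum_cong_neutral[THEN iffD1, rotated -1]) auto
  qed
  have support: "n \<in> L \<longleftrightarrow> (if n \<in> L then complex_of_real (A n) * cnj (zpow w n) else 0) \<noteq> 0"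
    if "P5 \<Omega> \<kappa> L A" for L A n
    using that zpow_w[of n] by (auto simp: P5_def)
  show ?thesis
    using support[OF assms(1)] support[OF assms(2)]
      fun_cong[OF taylor0_unique[OF taylor[OF assms(1)] taylor[OF assms(2)]]]
    by (intro set_eqI) metis
qed

end

theorem theorem2p11:
  fixes \<Omega> :: "(complex ^ 'm::finite) set"
    and H :: "(complex ^ 'm \<Rightarrow> complex) set"
    and ip :: "(complex ^ 'm \<Rightarrow> complex) \<Rightarrow> (complex ^ 'm \<Rightarrow> complex) \<Rightarrow> complex"
    and \<kappa> :: "complex ^ 'm \<Rightarrow> complex ^ 'm \<Rightarrow> complex"
  assumes "reinhardt_domain \<Omega>" and "0 \<in> \<Omega>"
    and "hilbert_fs \<Omega> H ip"
    and "repr_kernel \<Omega> H ip \<kappa>"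
    and "\<forall>j. \<forall>f\<in>H. (\<lambda>z. z $ j * f z) \<in> H"
    and "cont_incl_hol \<Omega> H ip"
  shows "(P1 \<Omega> \<kappa> \<longleftrightarrow> P2 H ip) \<and>
         (P2 H ip \<longleftrightarrow> (\<exists>\<beta> \<Lambda>. P3 H ip \<beta> \<Lambda>)) \<and>
         ((\<exists>\<beta> \<Lambda>. P3 H ip \<beta> \<Lambda>) \<longleftrightarrow> (\<exists>\<Lambda>'. P4 \<Omega> H ip \<Lambda>')) \<and>
         ((\<exists>\<Lambda>'. P4 \<Omega> H ip \<Lambda>') \<longleftrightarrow> (\<exists>\<Lambda>'' \<alpha>. P5 \<Omega> \<kappa> \<Lambda>'' \<alpha>)) \<and>
         (\<forall>\<beta> \<Lambda> \<Lambda>' \<Lambda>'' \<alpha>. P3 H ip \<beta> \<Lambda> \<and> P4 \<Omega> H ip \<Lambda>' \<and> P5 \<Omega> \<kappa> \<Lambda>'' \<alpha>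
            \<longrightarrow> \<Lambda> = \<Lambda>' \<and> \<Lambda>' = \<Lambda>'')"
proof -
  interpret reinhardt_rkhs \<Omega> H ip \<kappa>
    using assms by unfold_locales
  have P2_P4: "P2 H ip \<Longrightarrow> \<exists>\<Lambda>. P4 \<Omega> H ip \<Lambda>" using P2_imp_P4 by blast
  have P4_P5: "P4 \<Omega> H ip \<Lambda> \<Longrightarrow> \<exists>\<alpha>. P5 \<Omega> \<kappa> \<Lambda> \<alpha>" for \<Lambda> using P4_imp_P5 by blast
  have P4_P3: "P4 \<Omega> H ip \<Lambda> \<Longrightarrow> \<exists>\<beta>. P3 H ip \<beta> \<Lambda>" for \<Lambda> using P4_imp_P3 by blast
  have unique: "\<Lambda> = \<Lambda>' \<and> \<Lambda>' = \<Lambda>''"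
    if "P3 H ip \<beta> \<Lambda>" "P4 \<Omega> H ip \<Lambda>'" "P5 \<Omega> \<kappa> \<Lambda>'' \<alpha>" for \<beta> \<Lambda> \<Lambda>' \<Lambda>'' \<alpha>
  proof
    \<comment> \<open>\<open>P4_index\<close> works under \<open>P2\<close>, which the kernel series
      supplies through \<open>P1\<close>.\<close>
    have P2: "P2 H ip" using that(3) by (intro P1_imp_P2 P5_imp_P1)
    show "\<Lambda> = \<Lambda>'"
      using P4_index[OF P2 P3_imp_P4[OF that(1)]] P4_index[OF P2 that(2)] by simp
    \<comment> \<open>A monomial basis yields a kernel series over its own index set, and two such
      series share theirs.\<close>
    show "\<Lambda>' = \<Lambda>''" using P4_P5[OF that(2)] P5_index that(3) by blast
  qed
  have "P1 \<Omega> \<kappa> \<longleftrightarrow> P2 H ip" using P1_imp_P2 P2_P4 P4_P5 P5_imp_P1 by blast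
  moreover have "P2 H ip \<longleftrightarrow> (\<exists>\<beta> \<Lambda>. P3 H ip \<beta> \<Lambda>)"
    using P2_P4 P4_P3 P3_imp_P4 P4_P5 P5_imp_P1 P1_imp_P2 by metis
  moreover have "(\<exists>\<beta> \<Lambda>. P3 H ip \<beta> \<Lambda>) \<longleftrightarrow> (\<exists>\<Lambda>'. P4 \<Omega> H ip \<Lambda>')"
    using P4_P3 P3_imp_P4 by metis
  moreover have "(\<exists>\<Lambda>'. P4 \<Omega> H ip \<Lambda>') \<longleftrightarrow> (\<exists>\<Lambda>'' \<alpha>. P5 \<Omega> \<kappa> \<Lambda>'' \<alpha>)"
    using P4_P5 P5_imp_P1 P1_imp_P2 P2_P4 by metis
  ultimately show ?thesis using unique by (intro conjI allI impI; blast)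
qed

end
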